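(* (In $\mathrm{ZF}$.) The following are equivalent: (i) there is a large, well orderable, strongly concentrated set of real numbers; (ii) there is an injection from $\omega_1$ into $\mathbb{R}$ and $\mathrm{cf}(\aleph_1)=\aleph_0$.
   Context: Work in $\mathrm{ZF}$ (no choice). A set is large iff it is neither finite nor countable. A set $A\subseteq\mathbb{R}$ is concentrated on $D\subseteq\mathbb{R}$ iff for every open set $G\supseteq D$, $|A\setminus G|\le\aleph_0$; $A$ is strongly concentrated iff there is $c\in\mathbb{R}$ such that $A$ is concentrated on $\{c\}$. For an ordinal $\alpha$, $\mathrm{cf}(\aleph_\alpha)$ is the least $\aleph_\beta$ such that there is a family $\mathcal{A}$ of sets, each of cardinality $<\aleph_\alpha$, with $|\mathcal{A}|=\aleph_\beta$ and $|\bigcup\mathcal{A}|=\aleph_\alpha$. *)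

theory Defs
  imports Main
begin

text \<open>
  HOL has a choice operator, so a theorem of choiceless set theory cannot be stated about HOL sets.
  It is stated instead as: the equivalence holds in every structure \<open>('a, mem)\<close> satisfying the
  first-order axioms of ZF, which by the completeness theorem says that ZF proves it. Separation
  and replacement are schemes over the formulas of the language of set theory (with parameters);
  if they ranged over all HOL predicates, the choice operator would force the axiom of choice
  in the structure. All other notions are interpreted inside the structure: every object is of
  type \<open>'a\<close>, and in particular functions, relations and families are elements of the structure.
\<close>

datatype fm = Mem nat nat | Eq nat nat | Neg fm | Conj fm fm | All nat fm

primrec sats :: "('a \<Rightarrow> 'a \<Rightarrow> bool) \<Rightarrow> fm \<Rightarrow> (nat \<Rightarrow> 'a) \<Rightarrow> bool" where
  "sats mem (Mem i j) e \<longleftrightarrow> mem (e i) (e j)"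
| "sats mem (Eq i j) e \<longleftrightarrow> e i = e j"
| "sats mem (Neg p) e \<longleftrightarrow> \<not> sats mem p e"
| "sats mem (Conj p q) e \<longleftrightarrow> sats mem p e \<and> sats mem q e"
| "sats mem (All i p) e \<longleftrightarrow> (\<forall>a. sats mem p (e(i := a)))"

context
  fixes mem :: "'a \<Rightarrow> 'a \<Rightarrow> bool"  (infix "\<in>\<^sub>M" 50)
begin

definition M_subset :: "'a \<Rightarrow> 'a \<Rightarrow> bool"  (infix "\<subseteq>\<^sub>M" 50) where
  "A \<subseteq>\<^sub>M B \<longleftrightarrow> (\<forall>x. x \<in>\<^sub>M A \<longrightarrow> x \<in>\<^sub>M B)"

definition is_empty :: "'a \<Rightarrow> bool" where
  "is_empty A \<longleftrightarrow> (\<forall>x. \<not> x \<in>\<^sub>M A)"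

definition is_upair :: "'a \<Rightarrow> 'a \<Rightarrow> 'a \<Rightarrow> bool" where
  "is_upair p a b \<longleftrightarrow> (\<forall>x. x \<in>\<^sub>M p \<longleftrightarrow> x = a \<or> x = b)"

definition is_Union :: "'a \<Rightarrow> 'a \<Rightarrow> bool" where
  "is_Union U F \<longleftrightarrow> (\<forall>x. x \<in>\<^sub>M U \<longleftrightarrow> (\<exists>X. X \<in>\<^sub>M F \<and> x \<in>\<^sub>M X))"

definition is_Diff :: "'a \<Rightarrow> 'a \<Rightarrow> 'a \<Rightarrow> bool" where
  "is_Diff D A B \<longleftrightarrow> (\<forall>x. x \<in>\<^sub>M D \<longleftrightarrow> x \<in>\<^sub>M A \<and> \<not> x \<in>\<^sub>M B)"

definition is_succ :: "'a \<Rightarrow> 'a \<Rightarrow> bool" where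
  "is_succ s a \<longleftrightarrow> (\<forall>x. x \<in>\<^sub>M s \<longleftrightarrow> x \<in>\<^sub>M a \<or> x = a)"

definition is_inductive :: "'a \<Rightarrow> bool" where
  "is_inductive w \<longleftrightarrow>
     (\<exists>z. is_empty z \<and> z \<in>\<^sub>M w) \<and> (\<forall>n. n \<in>\<^sub>M w \<longrightarrow> (\<exists>s. is_succ s n \<and> s \<in>\<^sub>M w))"

end

locale ZF_model =
  fixes mem :: "'a \<Rightarrow> 'a \<Rightarrow> bool"  (infix "\<in>\<^sub>M" 50)
  assumes extensionality: "(\<forall>x. x \<in>\<^sub>M A \<longleftrightarrow> x \<in>\<^sub>M B) \<Longrightarrow> A = B"
    and foundation: "x \<in>\<^sub>M A \<Longrightarrow> \<exists>y. y \<in>\<^sub>M A \<and> \<not> (\<exists>z. z \<in>\<^sub>M A \<and> z \<in>\<^sub>M y)"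
    and pairing: "\<exists>p. is_upair mem p a b"
    and union: "\<exists>U. is_Union mem U F"
    and power_set: "\<exists>P. \<forall>X. X \<in>\<^sub>M P \<longleftrightarrow> M_subset mem X A"
    and infinity: "\<exists>w. is_inductive mem w"
    and separation: "\<exists>B. \<forall>x. x \<in>\<^sub>M B \<longleftrightarrow> x \<in>\<^sub>M A \<and> sats mem p (e(0 := x))"
    and replacement:
      "(\<forall>x y y'. x \<in>\<^sub>M A \<longrightarrow> sats mem p (e(0 := x, 1 := y)) \<longrightarrow> sats mem p (e(0 := x, 1 := y')) \<longrightarrow> y = y')
        \<Longrightarrow> \<exists>B. \<forall>y. y \<in>\<^sub>M B \<longleftrightarrow> (\<exists>x. x \<in>\<^sub>M A \<and> sats mem p (e(0 := x, 1 := y)))"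

context
  fixes mem :: "'a \<Rightarrow> 'a \<Rightarrow> bool"  (infix "\<in>\<^sub>M" 50)
begin

text \<open>Kuratowski pairs; \<open>related r a b\<close> says that the pair of \<open>a\<close> and \<open>b\<close> is an element of \<open>r\<close>.\<close>

definition is_pair :: "'a \<Rightarrow> 'a \<Rightarrow> 'a \<Rightarrow> bool" where
  "is_pair p a b \<longleftrightarrow> (\<forall>x. x \<in>\<^sub>M p \<longleftrightarrow> is_upair mem x a a \<or> is_upair mem x a b)"

definition related :: "'a \<Rightarrow> 'a \<Rightarrow> 'a \<Rightarrow> bool" where
  "related r a b \<longleftrightarrow> (\<exists>p. p \<in>\<^sub>M r \<and> is_pair p a b)"

definition is_function :: "'a \<Rightarrow> 'a \<Rightarrow> 'a \<Rightarrow> bool" where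
  "is_function f A B \<longleftrightarrow>
     (\<forall>p. p \<in>\<^sub>M f \<longrightarrow> (\<exists>a b. a \<in>\<^sub>M A \<and> b \<in>\<^sub>M B \<and> is_pair p a b)) \<and>
     (\<forall>a. a \<in>\<^sub>M A \<longrightarrow> (\<exists>!b. related f a b))"

definition is_injection :: "'a \<Rightarrow> 'a \<Rightarrow> 'a \<Rightarrow> bool" where
  "is_injection f A B \<longleftrightarrow> is_function f A B \<and>
     (\<forall>a a' b. related f a b \<longrightarrow> related f a' b \<longrightarrow> a = a')"

definition is_bijection :: "'a \<Rightarrow> 'a \<Rightarrow> 'a \<Rightarrow> bool" where
  "is_bijection f A B \<longleftrightarrow> is_injection f A B \<and> (\<forall>b. b \<in>\<^sub>M B \<longrightarrow> (\<exists>a. related f a b))"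

definition card_eq :: "'a \<Rightarrow> 'a \<Rightarrow> bool"  (infix "\<approx>\<^sub>M" 50) where
  "A \<approx>\<^sub>M B \<longleftrightarrow> (\<exists>f. is_bijection f A B)"

definition card_le :: "'a \<Rightarrow> 'a \<Rightarrow> bool"  (infix "\<lesssim>\<^sub>M" 50) where
  "A \<lesssim>\<^sub>M B \<longleftrightarrow> (\<exists>f. is_injection f A B)"

definition card_less :: "'a \<Rightarrow> 'a \<Rightarrow> bool"  (infix "\<prec>\<^sub>M" 50) where
  "A \<prec>\<^sub>M B \<longleftrightarrow> A \<lesssim>\<^sub>M B \<and> \<not> A \<approx>\<^sub>M B"

definition is_omega :: "'a \<Rightarrow> bool" where
  "is_omega w \<longleftrightarrow> is_inductive mem w \<and> (\<forall>v. is_inductive mem v \<longrightarrow> M_subset mem w v)"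

definition M_finite :: "'a \<Rightarrow> bool" where
  "M_finite A \<longleftrightarrow> (\<exists>w n. is_omega w \<and> n \<in>\<^sub>M w \<and> A \<approx>\<^sub>M n)"

definition M_countable :: "'a \<Rightarrow> bool" where
  "M_countable A \<longleftrightarrow> (\<exists>w. is_omega w \<and> A \<approx>\<^sub>M w)"

definition large :: "'a \<Rightarrow> bool" where
  "large A \<longleftrightarrow> \<not> M_finite A \<and> \<not> M_countable A"

definition strict_linear_order :: "'a \<Rightarrow> ('a \<Rightarrow> 'a \<Rightarrow> bool) \<Rightarrow> bool" where
  "strict_linear_order A prec \<longleftrightarrow>
     (\<forall>x. x \<in>\<^sub>M A \<longrightarrow> \<not> prec x x) \<and>
     (\<forall>x y z. x \<in>\<^sub>M A \<longrightarrow> y \<in>\<^sub>M A \<longrightarrow> z \<in>\<^sub>M A \<longrightarrow> prec x y \<longrightarrow> prec y z \<longrightarrow> prec x z) \<and>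
     (\<forall>x y. x \<in>\<^sub>M A \<longrightarrow> y \<in>\<^sub>M A \<longrightarrow> prec x y \<or> x = y \<or> prec y x)"

definition strict_well_order :: "'a \<Rightarrow> ('a \<Rightarrow> 'a \<Rightarrow> bool) \<Rightarrow> bool" where
  "strict_well_order A prec \<longleftrightarrow> strict_linear_order A prec \<and>
     (\<forall>S. M_subset mem S A \<longrightarrow> \<not> is_empty mem S \<longrightarrow>
        (\<exists>m. m \<in>\<^sub>M S \<and> (\<forall>x. x \<in>\<^sub>M S \<longrightarrow> m = x \<or> prec m x)))"

definition well_orderable :: "'a \<Rightarrow> bool" where
  "well_orderable A \<longleftrightarrow> (\<exists>r. strict_well_order A (related r))"

definition ordinal :: "'a \<Rightarrow> bool" where
  "ordinal a \<longleftrightarrow> (\<forall>x. x \<in>\<^sub>M a \<longrightarrow> M_subset mem x a) \<and> strict_well_order a (\<in>\<^sub>M)"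

text \<open>The alephs are the infinite initial ordinals, ordered by membership; the least one is
  \<open>\<omega>\<close>, which serves as \<open>\<aleph>\<^sub>0\<close>, and the next one is both \<open>\<aleph>\<^sub>1\<close> and \<open>\<omega>\<^sub>1\<close>.\<close>

definition is_aleph :: "'a \<Rightarrow> bool" where
  "is_aleph k \<longleftrightarrow> ordinal k \<and> \<not> M_finite k \<and> (\<forall>x. x \<in>\<^sub>M k \<longrightarrow> \<not> x \<approx>\<^sub>M k)"

definition is_aleph_1 :: "'a \<Rightarrow> bool" where
  "is_aleph_1 k \<longleftrightarrow> is_aleph k \<and>
     (\<exists>w. is_omega w \<and> w \<in>\<^sub>M k \<and>
        (\<forall>l. is_aleph l \<longrightarrow> w \<in>\<^sub>M l \<longrightarrow> l = k \<or> k \<in>\<^sub>M l))"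

text \<open>
  \<open>is_cf k l\<close> says that \<open>l\<close> is the cofinality of the aleph \<open>k\<close>: the least aleph that is the
  cardinality of a family of sets smaller than \<open>k\<close> whose union has cardinality \<open>k\<close>.
\<close>

definition union_of_smaller :: "'a \<Rightarrow> 'a \<Rightarrow> bool" where
  "union_of_smaller k l \<longleftrightarrow>
     (\<exists>F U. (\<forall>X. X \<in>\<^sub>M F \<longrightarrow> X \<prec>\<^sub>M k) \<and> F \<approx>\<^sub>M l \<and> is_Union mem U F \<and> U \<approx>\<^sub>M k)"

definition is_cf :: "'a \<Rightarrow> 'a \<Rightarrow> bool" where
  "is_cf k l \<longleftrightarrow> is_aleph l \<and> union_of_smaller k l \<and>
     (\<forall>m. is_aleph m \<longrightarrow> union_of_smaller k m \<longrightarrow> m = l \<or> l \<in>\<^sub>M m)"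

text \<open>
  A binary operation on \<open>R\<close> is a function from the set of pairs over \<open>R\<close> to \<open>R\<close>. The
  description in \<open>app2\<close> is only used at arguments in \<open>R\<close>, where the value is unique.
\<close>

definition app2_rel :: "'a \<Rightarrow> 'a \<Rightarrow> 'a \<Rightarrow> 'a \<Rightarrow> bool" where
  "app2_rel f x y z \<longleftrightarrow> (\<exists>p. is_pair p x y \<and> related f p z)"

definition app2 :: "'a \<Rightarrow> 'a \<Rightarrow> 'a \<Rightarrow> 'a" where
  "app2 f x y = (THE z. app2_rel f x y z)"

definition is_binop :: "'a \<Rightarrow> 'a \<Rightarrow> bool" where
  "is_binop f R \<longleftrightarrow>
     (\<forall>t. t \<in>\<^sub>M f \<longrightarrow> (\<exists>x y z p. x \<in>\<^sub>M R \<and> y \<in>\<^sub>M R \<and> z \<in>\<^sub>M R \<and> is_pair p x y \<and> is_pair t p z)) \<and>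
     (\<forall>x y. x \<in>\<^sub>M R \<longrightarrow> y \<in>\<^sub>M R \<longrightarrow> (\<exists>!z. app2_rel f x y z))"

definition is_field :: "'a \<Rightarrow> 'a \<Rightarrow> 'a \<Rightarrow> 'a \<Rightarrow> 'a \<Rightarrow> bool" where
  "is_field R add mul zero one \<longleftrightarrow>
     is_binop add R \<and> is_binop mul R \<and> zero \<in>\<^sub>M R \<and> one \<in>\<^sub>M R \<and> zero \<noteq> one \<and>
     (\<forall>x y z. x \<in>\<^sub>M R \<longrightarrow> y \<in>\<^sub>M R \<longrightarrow> z \<in>\<^sub>M R \<longrightarrow>
        app2 add (app2 add x y) z = app2 add x (app2 add y z) \<and>
        app2 mul (app2 mul x y) z = app2 mul x (app2 mul y z) \<and>
        app2 mul x (app2 add y z) = app2 add (app2 mul x y) (app2 mul x z)) \<and>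
     (\<forall>x y. x \<in>\<^sub>M R \<longrightarrow> y \<in>\<^sub>M R \<longrightarrow>
        app2 add x y = app2 add y x \<and> app2 mul x y = app2 mul y x) \<and>
     (\<forall>x. x \<in>\<^sub>M R \<longrightarrow> app2 add x zero = x \<and> app2 mul x one = x) \<and>
     (\<forall>x. x \<in>\<^sub>M R \<longrightarrow> (\<exists>y. y \<in>\<^sub>M R \<and> app2 add x y = zero)) \<and>
     (\<forall>x. x \<in>\<^sub>M R \<longrightarrow> x \<noteq> zero \<longrightarrow> (\<exists>y. y \<in>\<^sub>M R \<and> app2 mul x y = one))"

definition is_ordered_field :: "'a \<Rightarrow> 'a \<Rightarrow> 'a \<Rightarrow> 'a \<Rightarrow> bool" where
  "is_ordered_field R add mul lt \<longleftrightarrow> (\<exists>zero one. is_field R add mul zero one \<and>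
     strict_linear_order R (related lt) \<and>
     (\<forall>x y z. x \<in>\<^sub>M R \<longrightarrow> y \<in>\<^sub>M R \<longrightarrow> z \<in>\<^sub>M R \<longrightarrow>
        related lt x y \<longrightarrow> related lt (app2 add x z) (app2 add y z)) \<and>
     (\<forall>x y. x \<in>\<^sub>M R \<longrightarrow> y \<in>\<^sub>M R \<longrightarrow>
        related lt zero x \<longrightarrow> related lt zero y \<longrightarrow> related lt zero (app2 mul x y)))"

definition upper_bound :: "'a \<Rightarrow> 'a \<Rightarrow> 'a \<Rightarrow> 'a \<Rightarrow> bool" where
  "upper_bound R lt S u \<longleftrightarrow> u \<in>\<^sub>M R \<and> (\<forall>x. x \<in>\<^sub>M S \<longrightarrow> x = u \<or> related lt x u)"

text \<open>
  The real numbers of the structure are a Dedekind complete ordered field in it; ZF proves that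
  there is one and that it is unique up to isomorphism, the isomorphism being an element of the
  structure.
\<close>

definition is_real_numbers :: "'a \<Rightarrow> 'a \<Rightarrow> 'a \<Rightarrow> 'a \<Rightarrow> bool" where
  "is_real_numbers R add mul lt \<longleftrightarrow> is_ordered_field R add mul lt \<and>
     (\<forall>S. M_subset mem S R \<longrightarrow> \<not> is_empty mem S \<longrightarrow> (\<exists>u. upper_bound R lt S u) \<longrightarrow>
        (\<exists>u. upper_bound R lt S u \<and>
             (\<forall>v. upper_bound R lt S v \<longrightarrow> u = v \<or> related lt u v)))"

definition is_open :: "'a \<Rightarrow> 'a \<Rightarrow> 'a \<Rightarrow> bool" where
  "is_open R lt G \<longleftrightarrow> M_subset mem G R \<and>
     (\<forall>x. x \<in>\<^sub>M G \<longrightarrow> (\<exists>a b. a \<in>\<^sub>M R \<and> b \<in>\<^sub>M R \<and> related lt a x \<and> related lt x b \<and>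
        (\<forall>y. y \<in>\<^sub>M R \<longrightarrow> related lt a y \<longrightarrow> related lt y b \<longrightarrow> y \<in>\<^sub>M G)))"

definition concentrated :: "'a \<Rightarrow> 'a \<Rightarrow> 'a \<Rightarrow> 'a \<Rightarrow> bool" where
  "concentrated R lt A D \<longleftrightarrow> M_subset mem A R \<and> M_subset mem D R \<and>
     (\<forall>G X w. is_open R lt G \<longrightarrow> M_subset mem D G \<longrightarrow> is_Diff mem X A G \<longrightarrow> is_omega w \<longrightarrow>
        X \<lesssim>\<^sub>M w)"

definition strongly_concentrated :: "'a \<Rightarrow> 'a \<Rightarrow> 'a \<Rightarrow> bool" where
  "strongly_concentrated R lt A \<longleftrightarrow>
     (\<exists>c D. c \<in>\<^sub>M R \<and> is_upair mem D c c \<and> concentrated R lt A D)"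

end

end

theory Submission
  imports Defs
begin

text \<open>
  If \<open>A\<close> is well orderable and uncountable, then \<open>\<omega>\<^sub>1\<close> embeds into \<open>A\<close>; if moreover \<open>A\<close> is
  concentrated on \<open>c\<close>, then deleting the shrinking intervals around \<open>c\<close> exhausts \<open>\<omega>\<^sub>1\<close>, up to the
  point mapped to \<open>c\<close>, by countably many countable sets. Conversely, if \<open>\<omega>\<^sub>1\<close> is the union of
  countable sets \<open>T\<^sub>n\<close> and \<open>f\<close> injects it into the line, send \<open>\<beta>\<close> to \<open>1 / (n + r)\<close>, where \<open>n\<close> is least
  with \<open>\<beta> \<in> T\<^sub>n\<close> and \<open>r\<close> in \<open>(0, 1)\<close> encodes \<open>f \<beta>\<close>: all but countably many values lie in any
  given neighbourhood of \<open>0\<close>.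

  Both arguments use HOL functions and predicates on the type of the structure. These represent
  objects of the structure as long as they are definable with parameters, so definability is
  tracked along the way and discharged by introduction rules.
\<close>

text \<open>The obstacle throughout is the lack of choice. A countable union of countable sets need
  not be countable, and the equivalence is about just such a union. So unions are formed two sets at
  a time, by coding into even and odd numbers, and finite unions by an induction inside the
  structure. Selections are replaced by least elements: the least code of a preimage, the least
  index of a set containing a point. The structure may be nonstandard, so inductions and recursions
  run over definable predicates.

  The expression \<open>1 / (n + r)\<close> joins two requirements. The integer part of
  \<open>n + r\<close> gives back \<open>n\<close> and the rest gives back \<open>f \<beta>\<close>,
  so the map is injective. Its value is close to \<open>0\<close> as soon as \<open>n\<close> is
  large, whatever \<open>r\<close> is, so the points outside an interval around \<open>0\<close>
  have bounded indices and come from a finite union of countable sets. The Archimedean property,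
  through which completeness enters, supplies the bound.

  In the other direction the order type of \<open>A\<close> is an uncountable ordinal, and
  \<open>\<omega>\<^sub>1\<close> is found as the least one up to it.\<close>

section \<open>Definability\<close>

text \<open>
  Environments are used in the style of de Bruijn: a quantifier binds \<open>e 0\<close> and shifts the other
  variables. The constants are the parameters, so that a predicate of the form
  \<open>\<lambda>e. P (e 0) c\<close> needs no bookkeeping for \<open>c\<close>.
\<close>

inductive trm :: "((nat \<Rightarrow> 'a) \<Rightarrow> 'a) \<Rightarrow> bool" where
  var: "trm (\<lambda>e. e n)"
| const: "trm (\<lambda>e. c)"

inductive dfn :: "('a \<Rightarrow> 'a \<Rightarrow> bool) \<Rightarrow> ((nat \<Rightarrow> 'a) \<Rightarrow> bool) \<Rightarrow> bool" for mem where
  mem: "trm t \<Longrightarrow> trm u \<Longrightarrow> dfn mem (\<lambda>e. mem (t e) (u e))"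
| eq: "trm t \<Longrightarrow> trm u \<Longrightarrow> dfn mem (\<lambda>e. t e = u e)"
| neg: "dfn mem P \<Longrightarrow> dfn mem (\<lambda>e. \<not> P e)"
| conj: "dfn mem P \<Longrightarrow> dfn mem Q \<Longrightarrow> dfn mem (\<lambda>e. P e \<and> Q e)"
| all: "dfn mem (\<lambda>e. P (e 0) (\<lambda>n. e (Suc n))) \<Longrightarrow> dfn mem (\<lambda>e. \<forall>a. P a e)"

definition scons :: "'b \<Rightarrow> (nat \<Rightarrow> 'b) \<Rightarrow> nat \<Rightarrow> 'b" where
  "scons x f n = (case n of 0 \<Rightarrow> x | Suc m \<Rightarrow> f m)"

lemma scons_simps [simp]: "scons x f 0 = x" "scons x f (Suc n) = f n"
  by (simp_all add: scons_def)

lemma trm_subst: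
  assumes "trm t" "\<And>n. trm (s n)"
  shows "trm (\<lambda>e. t (\<lambda>n. s n e))"
  using assms by (cases) (auto intro: trm.const)

lemma dfn_trm_subst:
  assumes "dfn mem P" "\<And>n. trm (s n)"
  shows "dfn mem (\<lambda>e. P (\<lambda>n. s n e))"
  using assms
proof (induction arbitrary: s rule: dfn.induct)
  case (mem t u)
  show ?case by (rule dfn.mem; rule trm_subst; fact)
next
  case (eq t u)
  show ?case by (rule dfn.eq; rule trm_subst; fact)
next
  case (neg P)
  show ?case by (rule dfn.neg) (rule neg.IH[OF neg.prems])
next
  case (conj P Q)
  show ?case by (rule dfn.conj) (rule conj.IH(1)[OF conj.prems] conj.IH(2)[OF conj.prems])+
next
  case (all P)
  \<comment> \<open>Under the quantifier the bound variable stands for itself, and the terms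
    substituted for the other variables are shifted past it.\<close>
  define s' where "s' = scons (\<lambda>e. e 0) (\<lambda>n (e :: nat \<Rightarrow> 'a). s n (\<lambda>m. e (Suc m)))"
  have "trm (s' n)" for n
    by (cases n) (auto simp: s'_def intro: trm.var trm_subst[OF all.prems])
  from all.IH[where s = s', OF this] have "dfn mem (\<lambda>e. P (e 0) (\<lambda>n. s n (\<lambda>m. e (Suc m))))"
    by (simp add: s'_def)
  then show ?case by (rule dfn.all)
qed

section \<open>From definable predicates to formulas\<close>

lemma fresh_index: "finite T \<Longrightarrow> \<exists>k::nat. k \<notin> T"
  by (rule ex_new_if_finite) simp_all

text \<open>The predicates in \<open>dfn\<close> carry no syntax, so that they use finitely many
  variables has to be expressed semantically. It is what leaves room for a fresh bound variable when
  a quantifier is translated.\<close>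

definition supported :: "nat \<Rightarrow> ((nat \<Rightarrow> 'a) \<Rightarrow> 'b) \<Rightarrow> bool" where
  "supported N P \<longleftrightarrow> (\<forall>e e'. (\<forall>n<N. e n = e' n) \<longrightarrow> P e = P e')"

lemma supported_mono: "supported N P \<Longrightarrow> N \<le> N' \<Longrightarrow> supported N' P"
  unfolding supported_def by (meson less_le_trans)

lemma supported_comb: "supported N P \<Longrightarrow> supported N' Q \<Longrightarrow> supported (max N N') (\<lambda>e. h (P e) (Q e))"
  using supported_mono[of N P "max N N'"] supported_mono[of N' Q "max N N'"]
  unfolding supported_def by (metis max.cobounded1 max.cobounded2)

lemma trm_supported: "trm t \<Longrightarrow> \<exists>N. supported N t"
  by (erule trm.cases) (auto simp: supported_def)

lemma supported_all:
  assumes "supported N (\<lambda>e. P (e 0) (\<lambda>n. e (Suc n)))" "\<forall>n<N. e n = e' n"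
  shows "P a e = P a e'"
  using assms(1)[unfolded supported_def, rule_format, of "scons a e" "scons a e'"] assms(2)
  by (auto simp: scons_def split: nat.splits)

lemma dfn_supported: "dfn mem P \<Longrightarrow> \<exists>N. supported N P"
proof (induction rule: dfn.induct)
  case (mem t u)
  then show ?case using trm_supported[of t] trm_supported[of u] supported_comb[of _ t _ u mem]
    by blast
next
  case (eq t u)
  then show ?case using trm_supported[of t] trm_supported[of u] supported_comb[of _ t _ u "(=)"]
    by blast
next
  case (neg P)
  then show ?case unfolding supported_def by metis
next
  case (conj P Q)
  then show ?case using supported_comb[of _ P _ Q "(\<and>)"] by blast
next
  case (all P)
  then obtain N where N: "supported N (\<lambda>e. P (e 0) (\<lambda>n. e (Suc n)))" by (elim exE)
  have "supported N (\<lambda>e. \<forall>a. P a e)"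
    unfolding supported_def using supported_all[OF N] by blast
  then show ?case by (rule exI)
qed

text \<open>
  The constants of a definable predicate have to be placed in the environment: \<open>f\<close> places the
  free variables and \<open>g\<close> the constants. Arbitrary \<open>f\<close> make the induction work, as a quantifier
  is translated by a fresh name.
\<close>

definition realized :: "('a \<Rightarrow> 'a \<Rightarrow> bool) \<Rightarrow> 'a set \<Rightarrow> ((nat \<Rightarrow> 'a) \<Rightarrow> bool) \<Rightarrow> bool" where
  "realized mem S P \<longleftrightarrow>
     (\<forall>f g. \<exists>p. \<forall>e. (\<forall>c\<in>S. e (g c) = c) \<longrightarrow> sats mem p e = P (\<lambda>n. e (f n)))"

lemma trm_realized:
  assumes "trm t"
  shows "\<exists>S. finite S \<and> (\<forall>(f :: nat \<Rightarrow> nat) (g :: 'a \<Rightarrow> nat).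
    \<exists>i. \<forall>e. (\<forall>c\<in>S. e (g c) = c) \<longrightarrow> e i = t (\<lambda>n. e (f n)))"
  using assms
proof cases
  case (var n)
  show ?thesis unfolding var by (rule exI[of _ "{}"]) auto
next
  case (const c)
  show ?thesis unfolding const by (rule exI[of _ "{c}"]) auto
qed

text \<open>The finite set \<open>S\<close> of constants depends on \<open>P\<close> alone, while
  the formula may depend on the placements \<open>f\<close> and \<open>g\<close>. The quantifier
  case relies on this order: \<open>k\<close> is picked to avoid the places of \<open>S\<close>, and
  only then is the body translated for the placement \<open>scons k f\<close>.\<close>

lemma dfn_realized: "dfn mem P \<Longrightarrow> \<exists>S. finite S \<and> realized mem S P"
proof (induction rule: dfn.induct)
  case (mem t u)
  obtain S where 1: "finite S"
    "\<forall>(f :: nat \<Rightarrow> nat) (g :: 'a \<Rightarrow> nat).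
      \<exists>i. \<forall>e. (\<forall>c\<in>S. e (g c) = c) \<longrightarrow> e i = t (\<lambda>n. e (f n))"
    using trm_realized[OF mem(1)] by (elim exE conjE)
  obtain S' where 2: "finite S'"
    "\<forall>(f :: nat \<Rightarrow> nat) (g :: 'a \<Rightarrow> nat).
      \<exists>i. \<forall>e. (\<forall>c\<in>S'. e (g c) = c) \<longrightarrow> e i = u (\<lambda>n. e (f n))"
    using trm_realized[OF mem(2)] by (elim exE conjE)
  have "realized mem (S \<union> S') (\<lambda>e. mem (t e) (u e))"
    unfolding realized_def
  proof (intro allI)
    fix f :: "nat \<Rightarrow> nat" and g :: "'a \<Rightarrow> nat"
    obtain i where i: "\<forall>e. (\<forall>c\<in>S. e (g c) = c) \<longrightarrow> e i = t (\<lambda>n. e (f n))"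
      using 1(2)[rule_format, of g f] by (elim exE)
    obtain j where j: "\<forall>e. (\<forall>c\<in>S'. e (g c) = c) \<longrightarrow> e j = u (\<lambda>n. e (f n))"
      using 2(2)[rule_format, of g f] by (elim exE)
    show "\<exists>p. \<forall>e. (\<forall>c\<in>S \<union> S'. e (g c) = c) \<longrightarrow>
      sats mem p e = mem (t (\<lambda>n. e (f n))) (u (\<lambda>n. e (f n)))"
      using i j by (intro exI[of _ "Mem i j"]) auto
  qed
  then show ?case using 1(1) 2(1) by (intro exI[of _ "S \<union> S'"]) simp
next
  case (eq t u)
  obtain S where 1: "finite S"
    "\<forall>(f :: nat \<Rightarrow> nat) (g :: 'a \<Rightarrow> nat).
      \<exists>i. \<forall>e. (\<forall>c\<in>S. e (g c) = c) \<longrightarrow> e i = t (\<lambda>n. e (f n))"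
    using trm_realized[OF eq(1)] by (elim exE conjE)
  obtain S' where 2: "finite S'"
    "\<forall>(f :: nat \<Rightarrow> nat) (g :: 'a \<Rightarrow> nat).
      \<exists>i. \<forall>e. (\<forall>c\<in>S'. e (g c) = c) \<longrightarrow> e i = u (\<lambda>n. e (f n))"
    using trm_realized[OF eq(2)] by (elim exE conjE)
  have "realized mem (S \<union> S') (\<lambda>e. t e = u e)"
    unfolding realized_def
  proof (intro allI)
    fix f :: "nat \<Rightarrow> nat" and g :: "'a \<Rightarrow> nat"
    obtain i where i: "\<forall>e. (\<forall>c\<in>S. e (g c) = c) \<longrightarrow> e i = t (\<lambda>n. e (f n))"
      using 1(2)[rule_format, of g f] by (elim exE)
    obtain j where j: "\<forall>e. (\<forall>c\<in>S'. e (g c) = c) \<longrightarrow> e j = u (\<lambda>n. e (f n))"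
      using 2(2)[rule_format, of g f] by (elim exE)
    show "\<exists>p. \<forall>e. (\<forall>c\<in>S \<union> S'. e (g c) = c) \<longrightarrow>
      sats mem p e = (t (\<lambda>n. e (f n)) = u (\<lambda>n. e (f n)))"
      using i j by (intro exI[of _ "Eq i j"]) auto
  qed
  then show ?case using 1(1) 2(1) by (intro exI[of _ "S \<union> S'"]) simp
next
  case (neg P)
  then obtain S where S: "finite S" "realized mem S P" by blast
  have "realized mem S (\<lambda>e. \<not> P e)"
    unfolding realized_def
  proof (intro allI)
    fix f :: "nat \<Rightarrow> nat" and g :: "'a \<Rightarrow> nat"
    obtain p where "\<forall>e. (\<forall>c\<in>S. e (g c) = c) \<longrightarrow> sats mem p e = P (\<lambda>n. e (f n))"
      using S(2)[unfolded realized_def, rule_format, of g f] by (elim exE)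
    then show "\<exists>p. \<forall>e. (\<forall>c\<in>S. e (g c) = c) \<longrightarrow> sats mem p e = (\<not> P (\<lambda>n. e (f n)))"
      by (intro exI[of _ "Neg p"]) auto
  qed
  then show ?case using S(1) by blast
next
  case (conj P Q)
  then obtain S S' where S: "finite S" "realized mem S P" "finite S'" "realized mem S' Q" by blast
  have "realized mem (S \<union> S') (\<lambda>e. P e \<and> Q e)"
    unfolding realized_def
  proof (intro allI)
    fix f :: "nat \<Rightarrow> nat" and g :: "'a \<Rightarrow> nat"
    obtain p where p: "\<forall>e. (\<forall>c\<in>S. e (g c) = c) \<longrightarrow> sats mem p e = P (\<lambda>n. e (f n))"
      using S(2)[unfolded realized_def, rule_format, of g f] by (elim exE)
    obtain q where q: "\<forall>e. (\<forall>c\<in>S'. e (g c) = c) \<longrightarrow> sats mem q e = Q (\<lambda>n. e (f n))"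
      using S(4)[unfolded realized_def, rule_format, of g f] by (elim exE)
    show "\<exists>p. \<forall>e. (\<forall>c\<in>S \<union> S'. e (g c) = c) \<longrightarrow>
      sats mem p e = (P (\<lambda>n. e (f n)) \<and> Q (\<lambda>n. e (f n)))"
      using p q by (intro exI[of _ "Conj p q"]) auto
  qed
  then show ?case using S(1,3) by (intro exI[of _ "S \<union> S'"]) simp
next
  case (all P)
  obtain N where N: "supported N (\<lambda>e. P (e 0) (\<lambda>n. e (Suc n)))"
    using dfn_supported[OF all.hyps] by (elim exE)
  obtain S where S: "finite S" "realized mem S (\<lambda>e. P (e 0) (\<lambda>n. e (Suc n)))"
    using all.IH by (elim exE conjE)
  have "realized mem S (\<lambda>e. \<forall>a. P a e)"
    unfolding realized_def
  proof (intro allI)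
    fix f :: "nat \<Rightarrow> nat" and g :: "'a \<Rightarrow> nat"
    \<comment> \<open>The new name must avoid the places of the constants and of the variables that
      the body can see. The support bound makes the latter finite in number, whereas the range of
      \<open>f\<close> may be all of \<open>nat\<close>.\<close>
    obtain k where k: "k \<notin> f ` {..<N} \<union> g ` S"
      using fresh_index[of "f ` {..<N} \<union> g ` S"] S(1) by auto
    obtain p where p: "\<forall>e. (\<forall>c\<in>S. e (g c) = c) \<longrightarrow>
       sats mem p e = P (e (scons k f 0)) (\<lambda>n. e (scons k f (Suc n)))"
      using S(2)[unfolded realized_def, rule_format, of g "scons k f"] by (elim exE)
    have "sats mem p (e(k := a)) = P a (\<lambda>n. e (f n))" if e: "\<forall>c\<in>S. e (g c) = c" for e a
    proof -
      have "\<forall>c\<in>S. (e(k := a)) (g c) = c" using e k by auto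
      then have "sats mem p (e(k := a)) = P a (\<lambda>n. (e(k := a)) (f n))"
        using p[rule_format, of "e(k := a)"] by simp
      also have "\<dots> = P a (\<lambda>n. e (f n))" by (rule supported_all[OF N]) (use k in auto)
      finally show ?thesis .
    qed
    then show "\<exists>p. \<forall>e. (\<forall>c\<in>S. e (g c) = c) \<longrightarrow> sats mem p e = (\<forall>a. P a (\<lambda>n. e (f n)))"
      by (intro exI[of _ "All k p"]) simp
  qed
  then show ?case using S(1) by blast
qed

text \<open>Constants are stored from place \<open>k\<close> on, so that the places below
  \<open>k\<close> stay free for the variables of an axiom scheme: one for separation, two for
  replacement.\<close>

lemma dfn_sats:
  assumes "dfn mem P"
  shows "\<exists>p e. \<forall>e'. (\<forall>n\<ge>k. e' n = e n) \<longrightarrow> sats mem p e' = P e'"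
proof -
  obtain S where S: "finite S" "realized mem S P" using dfn_realized[OF assms] by blast
  obtain g0 :: "'a \<Rightarrow> nat" where g0: "inj_on g0 S"
    using finite_imp_inj_to_nat_seg[OF S(1)] by (elim exE conjE)
  define g where "g c = g0 c + k" for c
  have g_le: "k \<le> g c" for c by (simp add: g_def)
  have g: "inj_on g S" using g0 by (auto simp: inj_on_def g_def)
  obtain p where p: "\<forall>e. (\<forall>c\<in>S. e (g c) = c) \<longrightarrow> sats mem p e = P (\<lambda>n. e n)"
    using S(2)[unfolded realized_def, rule_format, of g "\<lambda>n. n"] by (elim exE)
  have "\<forall>e'. (\<forall>n\<ge>k. e' n = inv_into S g n) \<longrightarrow> sats mem p e' = P e'"
  proof (intro allI impI)
    fix e' :: "nat \<Rightarrow> 'a" assume "\<forall>n\<ge>k. e' n = inv_into S g n"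
    then have "e' (g c) = c" if "c \<in> S" for c
      using that inv_into_f_f[OF g that] g_le[of c] by simp
    then show "sats mem p e' = P e'" using p by simp
  qed
  then show ?thesis by blast
qed

context ZF_model
begin

section \<open>Closure of definability under connectives, quantifiers and terms\<close>

abbreviation Dfn :: "((nat \<Rightarrow> 'a) \<Rightarrow> bool) \<Rightarrow> bool" where "Dfn \<equiv> dfn mem"

lemma Dfn_neg: "Dfn P \<Longrightarrow> Dfn (\<lambda>e. \<not> P e)"
  by (rule dfn.neg)

lemma Dfn_conj: "Dfn P \<Longrightarrow> Dfn Q \<Longrightarrow> Dfn (\<lambda>e. P e \<and> Q e)"
  by (rule dfn.conj)

lemma Dfn_all: "Dfn (\<lambda>e. P (e 0) (\<lambda>n. e (Suc n))) \<Longrightarrow> Dfn (\<lambda>e. \<forall>a. P a e)"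
  by (rule dfn.all)

lemma Dfn_disj: "Dfn P \<Longrightarrow> Dfn Q \<Longrightarrow> Dfn (\<lambda>e. P e \<or> Q e)"
  using dfn.neg[OF dfn.conj[OF dfn.neg dfn.neg], of mem P Q] by simp

lemma Dfn_imp: "Dfn P \<Longrightarrow> Dfn Q \<Longrightarrow> Dfn (\<lambda>e. P e \<longrightarrow> Q e)"
  unfolding imp_conv_disj by (intro Dfn_disj Dfn_neg)

lemma Dfn_iff: "Dfn P \<Longrightarrow> Dfn Q \<Longrightarrow> Dfn (\<lambda>e. P e \<longleftrightarrow> Q e)"
  unfolding iff_conv_conj_imp by (intro Dfn_conj Dfn_imp)

lemma Dfn_ex: "Dfn (\<lambda>e. P (e 0) (\<lambda>n. e (Suc n))) \<Longrightarrow> Dfn (\<lambda>e. \<exists>a. P a e)"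
  using dfn.neg[OF dfn.all[of mem "\<lambda>a e. \<not> P a e", OF dfn.neg]] by simp

text \<open>A HOL truth value that does not depend on the environment is expressed by an equation
  between equal constants or by its negation.\<close>

lemma Dfn_const: "Dfn (\<lambda>e. b)"
proof -
  have t: "Dfn (\<lambda>e. undefined = (undefined :: 'a))" by (intro dfn.eq trm.const)
  then show ?thesis using dfn.neg[OF t] by (cases b) simp_all
qed

text \<open>A term is definable if its graph is, with the value as the new variable \<open>e 0\<close>.\<close>

definition dtm :: "((nat \<Rightarrow> 'a) \<Rightarrow> 'a) \<Rightarrow> bool" where
  "dtm t \<longleftrightarrow> Dfn (\<lambda>e. e 0 = t (\<lambda>n. e (Suc n)))"

lemma dtm_var: "dtm (\<lambda>e. e n)"
  unfolding dtm_def by (intro dfn.eq trm.var)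

lemma dtm_const: "dtm (\<lambda>e. c)"
  unfolding dtm_def by (intro dfn.eq trm.var trm.const)

text \<open>The number \<open>k\<close> counts the quantifiers put in front of the term since its
  variables were numbered; \<open>i\<close> is the variable that names its value.\<close>

lemma Dfn_eq_var: "dtm t \<Longrightarrow> Dfn (\<lambda>e. e i = t (\<lambda>n. e (n + k)))"
proof -
  assume t: "dtm t"
  have "trm (scons (\<lambda>e. e i) (\<lambda>n e. e (n + k)) n)" for n
    by (cases n) (auto intro: trm.var)
  from dfn_trm_subst[where s = "scons (\<lambda>e. e i) (\<lambda>n e. e (n + k))", OF t[unfolded dtm_def] this] show ?thesis by simp
qed

lemma Dfn_vars: "Dfn P \<Longrightarrow> Dfn (\<lambda>e. P (\<lambda>n. e (f n)))"
  by (erule dfn_trm_subst[where s = "\<lambda>n e. e (f n)"]) (rule trm.var)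

text \<open>The language has no function symbols, so a compound argument is named by an existential
  quantifier. \<open>P\<close> sees the environment only through its argument, hence is unaffected
  by the new binder.\<close>

lemma Dfn_lift1:
  assumes P: "Dfn (\<lambda>e. P (e 0))" and t: "dtm t"
  shows "Dfn (\<lambda>e. P (t e))"
proof -
  have "Dfn (\<lambda>e. \<exists>x. x = t e \<and> P x)"
    using Dfn_eq_var[OF t, of 0 1] P
    by (intro Dfn_ex Dfn_conj) simp_all
  then show ?thesis by simp
qed

lemma Dfn_lift2:
  assumes P: "Dfn (\<lambda>e. P (e 0) (e 1))" and t: "dtm t" and u: "dtm u"
  shows "Dfn (\<lambda>e. P (t e) (u e))"
proof -
  have "Dfn (\<lambda>e. \<exists>y. y = u e \<and> (\<exists>x. x = t e \<and> P x y))"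
    using Dfn_eq_var[OF u, of 0 1] Dfn_eq_var[OF t, of 0 2] P
    by (intro Dfn_ex Dfn_conj) simp_all
  then show ?thesis by simp
qed

lemma Dfn_lift3:
  assumes P: "Dfn (\<lambda>e. P (e 0) (e 1) (e 2))" and t: "dtm t" and u: "dtm u" and v: "dtm v"
  shows "Dfn (\<lambda>e. P (t e) (u e) (v e))"
proof -
  have "Dfn (\<lambda>e. \<exists>z. z = v e \<and> (\<exists>y. y = u e \<and> (\<exists>x. x = t e \<and> P x y z)))"
    using Dfn_eq_var[OF v, of 0 1] Dfn_eq_var[OF u, of 0 2] Dfn_eq_var[OF t, of 0 3] P
    by (intro Dfn_ex Dfn_conj) (simp_all add: numeral_2_eq_2 numeral_3_eq_3)
  then show ?thesis by simp
qed

lemma dtm_shift: "dtm t \<Longrightarrow> dtm (\<lambda>e. t (\<lambda>n. e (Suc n)))"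
  using Dfn_eq_var[of t 0 2] unfolding dtm_def[of "\<lambda>e. t (\<lambda>n. e (Suc n))"] by simp

lemma dtm_lift1:
  assumes F: "dtm (\<lambda>e. F (e 0))" and t: "dtm t"
  shows "dtm (\<lambda>e. F (t e))"
  unfolding dtm_def
  by (rule Dfn_lift2[where P = "\<lambda>x y. x = F y"])
    (use F dtm_shift[OF t] in \<open>simp_all add: dtm_def dtm_var[unfolded dtm_def]\<close>)

lemma dtm_lift2:
  assumes F: "dtm (\<lambda>e. F (e 0) (e 1))" and t: "dtm t" and u: "dtm u"
  shows "dtm (\<lambda>e. F (t e) (u e))"
  unfolding dtm_def
  by (rule Dfn_lift3[where P = "\<lambda>x y z. x = F y z"])
    (use F dtm_shift[OF t] dtm_shift[OF u] in
      \<open>simp_all add: dtm_def dtm_var[unfolded dtm_def] numeral_2_eq_2\<close>)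

lemma Dfn_mem: "dtm t \<Longrightarrow> dtm u \<Longrightarrow> Dfn (\<lambda>e. t e \<in>\<^sub>M u e)"
  by (rule Dfn_lift2) (intro dfn.mem trm.var)

lemma Dfn_eq: "dtm t \<Longrightarrow> dtm u \<Longrightarrow> Dfn (\<lambda>e. t e = u e)"
  by (rule Dfn_lift2) (intro dfn.eq trm.var)

lemma Dfn_ex1: "Dfn (\<lambda>e. P (e 0) (\<lambda>n. e (Suc n))) \<Longrightarrow> Dfn (\<lambda>e. \<exists>!a. P a e)"
proof -
  assume P: "Dfn (\<lambda>e. P (e 0) (\<lambda>n. e (Suc n)))"
  have "Dfn (\<lambda>e. P (e 0) (\<lambda>n. e (Suc (Suc n))))"
    using Dfn_vars[OF P, of "scons 0 (\<lambda>n. Suc (Suc n))"] by simp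
  then have "Dfn (\<lambda>e. \<exists>x. P x e \<and> (\<forall>y. P y e \<longrightarrow> y = x))"
    using P by (intro Dfn_ex Dfn_conj Dfn_all Dfn_imp Dfn_eq dtm_var)
  then show ?thesis by (simp add: Ex1_def)
qed

text \<open>
  Unlike \<open>THE\<close>, whose value at a predicate without a unique witness is not determined, this
  description is definable everywhere.
\<close>

definition descr :: "('a \<Rightarrow> bool) \<Rightarrow> 'a" where
  "descr P = (if \<exists>!x. P x then THE x. P x else undefined)"

lemma descr_eq: "P a \<Longrightarrow> (\<And>x. P x \<Longrightarrow> x = a) \<Longrightarrow> descr P = a"
  unfolding descr_def by (metis the_equality)

lemma dtm_descr:
  assumes "Dfn (\<lambda>e. P (e 0) (\<lambda>n. e (Suc n)))"
  shows "dtm (\<lambda>e. descr (\<lambda>x. P x e))"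
proof -
  have *: "(y = descr Q) \<longleftrightarrow> ((\<exists>!x. Q x) \<and> Q y) \<or> (\<not> (\<exists>!x. Q x) \<and> y = undefined)" for y Q
    unfolding descr_def by (auto intro: the_equality[symmetric] theI)
  have "Dfn (\<lambda>e. P (e 0) (\<lambda>n. e (Suc (Suc n))))"
    using Dfn_vars[OF assms, of "scons 0 (\<lambda>n. Suc (Suc n))"] by simp
  then show ?thesis
    unfolding dtm_def * using assms
    by (intro Dfn_conj Dfn_disj Dfn_neg Dfn_eq Dfn_ex1 dtm_var dtm_const)
qed

lemma dtm_if: "Dfn P \<Longrightarrow> dtm t \<Longrightarrow> dtm u \<Longrightarrow> dtm (\<lambda>e. if P e then t e else u e)"
proof -
  assume 1: "Dfn P" "dtm t" "dtm u"
  have *: "(y = (if b then x else z)) \<longleftrightarrow> (b \<and> y = x) \<or> (\<not> b \<and> y = z)" for b and x y z :: 'a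
    by auto
  have "Dfn (\<lambda>e. P (\<lambda>n. e (Suc n)))" using Dfn_vars[OF 1(1)] .
  then show ?thesis
    unfolding dtm_def * using 1(2,3)[unfolded dtm_def] by (intro Dfn_conj Dfn_disj Dfn_neg)
qed

lemmas dfn_intros = Dfn_const Dfn_mem Dfn_eq Dfn_neg Dfn_conj Dfn_disj Dfn_imp Dfn_iff Dfn_all Dfn_ex
  Dfn_ex1 dtm_const dtm_var dtm_descr dtm_if

section \<open>Separation and replacement for definable predicates\<close>

lemma separation_dfn:
  assumes "Dfn (\<lambda>e. P (e 0))"
  shows "\<exists>B. \<forall>x. x \<in>\<^sub>M B \<longleftrightarrow> x \<in>\<^sub>M A \<and> P x"
proof -
  obtain p e where p: "\<forall>e'. (\<forall>n\<ge>1. e' n = e n) \<longrightarrow> sats mem p e' = P (e' 0)"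
    using dfn_sats[OF assms, of 1] by (elim exE)
  have "sats mem p (e(0 := x)) = P x" for x
    using p[rule_format, of "e(0 := x)"] by simp
  then show ?thesis using separation[of A p e] by simp
qed

lemma replacement_dfn:
  assumes "Dfn (\<lambda>e. P (e 0) (e 1))" "\<And>x y y'. x \<in>\<^sub>M A \<Longrightarrow> P x y \<Longrightarrow> P x y' \<Longrightarrow> y = y'"
  shows "\<exists>B. \<forall>y. y \<in>\<^sub>M B \<longleftrightarrow> (\<exists>x. x \<in>\<^sub>M A \<and> P x y)"
proof -
  obtain p e where p: "\<forall>e'. (\<forall>n\<ge>2. e' n = e n) \<longrightarrow> sats mem p e' = P (e' 0) (e' 1)"
    using dfn_sats[OF assms(1), of 2] by (elim exE)
  have *: "sats mem p (e(0 := x, 1 := y)) = P x y" for x y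
    using p[rule_format, of "e(0 := x, 1 := y)"] by simp
  show ?thesis
    using replacement[of A p e] assms(2) unfolding * by blast
qed

section \<open>Set theory in the structure\<close>

abbreviation fdef :: "('a \<Rightarrow> 'a) \<Rightarrow> bool" where "fdef F \<equiv> dtm (\<lambda>e. F (e 0))"
abbreviation dfn1 :: "('a \<Rightarrow> bool) \<Rightarrow> bool" where "dfn1 P \<equiv> Dfn (\<lambda>e. P (e 0))"
abbreviation dfn2 :: "('a \<Rightarrow> 'a \<Rightarrow> bool) \<Rightarrow> bool" where "dfn2 P \<equiv> Dfn (\<lambda>e. P (e 0) (e 1))"

lemma dtm_vars: "dtm t \<Longrightarrow> dtm (\<lambda>e. t (\<lambda>n. e (f n)))"
  unfolding dtm_def using Dfn_vars[where f = "scons 0 (\<lambda>n. Suc (f n))", of "\<lambda>e. e 0 = t (\<lambda>n. e (Suc n))"]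
  by simp

text \<open>Extensionality makes the described set unique, and if the class is not a set,
  \<open>descr\<close> falls back to its default. Definability and existence thereby become separate
  questions; \<open>mem_setof\<close> takes existence as its premise.\<close>

definition setof :: "('a \<Rightarrow> bool) \<Rightarrow> 'a" where
  "setof P = descr (\<lambda>B. \<forall>x. x \<in>\<^sub>M B \<longleftrightarrow> P x)"

lemma mem_setof: "\<exists>B. \<forall>x. x \<in>\<^sub>M B \<longleftrightarrow> P x \<Longrightarrow> x \<in>\<^sub>M setof P \<longleftrightarrow> P x"
  unfolding setof_def by (erule exE, subst descr_eq) (auto intro: extensionality)

lemma dtm_setof:
  assumes "Dfn (\<lambda>e. P (e 0) (\<lambda>n. e (Suc n)))"
  shows "dtm (\<lambda>e. setof (\<lambda>x. P x e))"
proof -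
  have "Dfn (\<lambda>e. P (e 0) (\<lambda>n. e (Suc (Suc n))))"
    using Dfn_vars[OF assms, of "scons 0 (\<lambda>n. Suc (Suc n))"] by simp
  then show ?thesis
    unfolding setof_def by (intro dfn_intros)
qed

definition sep :: "'a \<Rightarrow> ('a \<Rightarrow> bool) \<Rightarrow> 'a" where
  "sep A P = setof (\<lambda>x. x \<in>\<^sub>M A \<and> P x)"

lemma mem_sep: "dfn1 P \<Longrightarrow> x \<in>\<^sub>M sep A P \<longleftrightarrow> x \<in>\<^sub>M A \<and> P x"
  unfolding sep_def by (intro mem_setof separation_dfn)

lemma dtm_sep:
  "dtm A \<Longrightarrow> Dfn (\<lambda>e. P (e 0) (\<lambda>n. e (Suc n))) \<Longrightarrow> dtm (\<lambda>e. sep (A e) (\<lambda>x. P x e))"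
  unfolding sep_def by (intro dtm_setof dfn_intros dtm_shift[of A])

definition img :: "'a \<Rightarrow> ('a \<Rightarrow> 'a) \<Rightarrow> 'a" where
  "img A F = setof (\<lambda>y. \<exists>x. x \<in>\<^sub>M A \<and> y = F x)"

lemma mem_img: "fdef F \<Longrightarrow> y \<in>\<^sub>M img A F \<longleftrightarrow> (\<exists>x. x \<in>\<^sub>M A \<and> y = F x)"
  unfolding img_def
  by (intro mem_setof replacement_dfn dfn_intros) (auto intro: dtm_lift1)

lemma dtm_img:
  assumes "dtm A" "dtm (\<lambda>e. F (e 0) (\<lambda>n. e (Suc n)))"
  shows "dtm (\<lambda>e. img (A e) (\<lambda>x. F x e))"
proof -
  have "dtm (\<lambda>e. F (e 0) (\<lambda>n. e (Suc (Suc n))))"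
    using dtm_vars[OF assms(2), of "scons 0 (\<lambda>n. Suc (Suc n))"] by simp
  then show ?thesis
    unfolding img_def using dtm_shift[OF dtm_shift[OF assms(1)]] by (intro dtm_setof dfn_intros)
qed

definition emp :: 'a where "emp = setof (\<lambda>x. False)"
definition upair :: "'a \<Rightarrow> 'a \<Rightarrow> 'a" where "upair a b = setof (\<lambda>x. x = a \<or> x = b)"
definition pair :: "'a \<Rightarrow> 'a \<Rightarrow> 'a" where "pair a b = upair (upair a a) (upair a b)"
definition bigun :: "'a \<Rightarrow> 'a" where "bigun F = setof (\<lambda>x. \<exists>X. X \<in>\<^sub>M F \<and> x \<in>\<^sub>M X)"
definition pow :: "'a \<Rightarrow> 'a" where "pow A = setof (\<lambda>X. M_subset mem X A)"
definition succ :: "'a \<Rightarrow> 'a" where "succ a = setof (\<lambda>x. x \<in>\<^sub>M a \<or> x = a)"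
definition un :: "'a \<Rightarrow> 'a \<Rightarrow> 'a" where "un A B = bigun (upair A B)"
definition app :: "'a \<Rightarrow> 'a \<Rightarrow> 'a" where "app f x = descr (\<lambda>y. pair x y \<in>\<^sub>M f)"

lemma mem_emp [simp]: "\<not> x \<in>\<^sub>M emp"
proof -
  have "\<exists>B. \<forall>x. x \<in>\<^sub>M B \<longleftrightarrow> False" using separation_dfn[of "\<lambda>x. False", OF Dfn_const] by auto
  then show ?thesis unfolding emp_def by (subst mem_setof) auto
qed

lemma mem_upair [simp]: "x \<in>\<^sub>M upair a b \<longleftrightarrow> x = a \<or> x = b"
  unfolding upair_def using pairing[of a b] by (intro mem_setof) (simp add: is_upair_def)

lemma mem_bigun [simp]: "x \<in>\<^sub>M bigun F \<longleftrightarrow> (\<exists>X. X \<in>\<^sub>M F \<and> x \<in>\<^sub>M X)"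
  unfolding bigun_def using union[of F] by (intro mem_setof) (simp add: is_Union_def)

lemma mem_pow [simp]: "X \<in>\<^sub>M pow A \<longleftrightarrow> M_subset mem X A"
  unfolding pow_def using power_set[of A] by (intro mem_setof)

lemma mem_un [simp]: "x \<in>\<^sub>M un A B \<longleftrightarrow> x \<in>\<^sub>M A \<or> x \<in>\<^sub>M B"
  unfolding un_def by auto

lemma mem_succ [simp]: "x \<in>\<^sub>M succ a \<longleftrightarrow> x \<in>\<^sub>M a \<or> x = a"
  unfolding succ_def by (intro mem_setof exI[of _ "un a (upair a a)"]) auto

lemma Dfn_subset: "dtm t \<Longrightarrow> dtm u \<Longrightarrow> Dfn (\<lambda>e. M_subset mem (t e) (u e))"
  by (erule (1) Dfn_lift2[rotated]) (unfold M_subset_def, intro dfn_intros)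

lemma dtm_upair: "dtm t \<Longrightarrow> dtm u \<Longrightarrow> dtm (\<lambda>e. upair (t e) (u e))"
  by (erule (1) dtm_lift2[rotated]) (unfold upair_def, intro dfn_intros dtm_setof)

lemma dtm_pair: "dtm t \<Longrightarrow> dtm u \<Longrightarrow> dtm (\<lambda>e. pair (t e) (u e))"
  by (erule (1) dtm_lift2[rotated]) (unfold pair_def, intro dfn_intros dtm_upair)

lemma dtm_bigun: "dtm t \<Longrightarrow> dtm (\<lambda>e. bigun (t e))"
  by (erule dtm_lift1[rotated]) (unfold bigun_def, intro dfn_intros dtm_setof)

lemma dtm_un: "dtm t \<Longrightarrow> dtm u \<Longrightarrow> dtm (\<lambda>e. un (t e) (u e))"
  by (erule (1) dtm_lift2[rotated]) (unfold un_def, intro dfn_intros dtm_upair dtm_bigun)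

lemma dtm_succ: "dtm t \<Longrightarrow> dtm (\<lambda>e. succ (t e))"
  by (erule dtm_lift1[rotated]) (unfold succ_def, intro dfn_intros dtm_setof)

lemma dtm_app: "dtm t \<Longrightarrow> dtm u \<Longrightarrow> dtm (\<lambda>e. app (t e) (u e))"
  by (erule (1) dtm_lift2[rotated]) (unfold app_def, intro dfn_intros dtm_pair)

lemma is_upair_iff [simp]: "is_upair mem p a b \<longleftrightarrow> p = upair a b"
  unfolding is_upair_def by (auto intro: extensionality)

lemma is_pair_iff [simp]: "is_pair mem p a b \<longleftrightarrow> p = pair a b"
  unfolding is_pair_def by (auto simp: pair_def intro: extensionality)

lemma upair_eq_iff: "upair a b = upair c d \<longleftrightarrow> (a = c \<and> b = d) \<or> (a = d \<and> b = c)"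
proof
  assume "upair a b = upair c d"
  then have "\<And>x. (x = a \<or> x = b) = (x = c \<or> x = d)" by (metis mem_upair)
  then show "(a = c \<and> b = d) \<or> (a = d \<and> b = c)" by metis
qed (auto intro: extensionality)

lemma pair_eq_iff [simp]: "pair a b = pair c d \<longleftrightarrow> a = c \<and> b = d"
  unfolding pair_def upair_eq_iff by metis

lemma related_iff: "related mem r a b \<longleftrightarrow> pair a b \<in>\<^sub>M r"
  unfolding related_def by simp

lemmas dfn_set_intros = dfn_intros Dfn_subset dtm_setof dtm_sep dtm_img dtm_upair dtm_pair dtm_bigun
  dtm_un dtm_succ dtm_app

lemma Dfn_related: "dtm r \<Longrightarrow> dtm t \<Longrightarrow> dtm u \<Longrightarrow> Dfn (\<lambda>e. related mem (r e) (t e) (u e))"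
  unfolding related_iff by (intro dfn_set_intros)

subsection \<open>Functions\<close>

definition graph :: "'a \<Rightarrow> ('a \<Rightarrow> 'a) \<Rightarrow> 'a" where
  "graph A F = img A (\<lambda>x. pair x (F x))"

lemma mem_graph: "fdef F \<Longrightarrow> p \<in>\<^sub>M graph A F \<longleftrightarrow> (\<exists>x. x \<in>\<^sub>M A \<and> p = pair x (F x))"
  unfolding graph_def by (subst mem_img) (auto intro: dfn_set_intros)

lemma app_graph: "fdef F \<Longrightarrow> x \<in>\<^sub>M A \<Longrightarrow> app (graph A F) x = F x"
  unfolding app_def by (rule descr_eq) (auto simp: mem_graph)

lemma is_function_graph:
  "fdef F \<Longrightarrow> (\<And>x. x \<in>\<^sub>M A \<Longrightarrow> F x \<in>\<^sub>M B) \<Longrightarrow> is_function mem (graph A F) A B"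
  unfolding is_function_def related_iff by (auto simp: mem_graph)

lemma is_function_related:
  assumes "is_function mem f A B"
  shows "related mem f a b \<longleftrightarrow> a \<in>\<^sub>M A \<and> b = app f a"
proof -
  have A: "a \<in>\<^sub>M A" if "pair a b \<in>\<^sub>M f" for a b
    using assms that unfolding is_function_def by (metis is_pair_iff pair_eq_iff)
  have "app f a = b" if "pair a b \<in>\<^sub>M f" for a b
    unfolding app_def using that A[OF that] assms
    by (intro descr_eq) (auto simp: is_function_def related_iff)
  with A show ?thesis
    using assms unfolding is_function_def related_iff by metis
qed

lemma is_function_app: "is_function mem f A B \<Longrightarrow> a \<in>\<^sub>M A \<Longrightarrow> app f a \<in>\<^sub>M B"
  using is_function_related[of f A B a "app f a"] unfolding is_function_def related_iff
  by (metis is_pair_iff pair_eq_iff)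

text \<open>Replacement turns a definable HOL map into its graph, an element of the structure.
  Conversely, a function of the structure acts through \<open>app\<close>, which is definable with
  the function as a parameter. The introduction and elimination rules from here on let cardinal
  comparisons be argued with HOL maps.\<close>

lemma card_leI:
  assumes "fdef F" "\<And>x. x \<in>\<^sub>M A \<Longrightarrow> F x \<in>\<^sub>M B"
    "\<And>x y. x \<in>\<^sub>M A \<Longrightarrow> y \<in>\<^sub>M A \<Longrightarrow> F x = F y \<Longrightarrow> x = y"
  shows "card_le mem A B"
  unfolding card_le_def is_injection_def
  using is_function_graph[OF assms(1,2)] assms(3)
  by (intro exI[of _ "graph A F"]) (auto simp: related_iff mem_graph[OF assms(1)])

lemma card_leE:
  assumes "card_le mem A B"
  obtains F where "fdef F" "\<And>x. x \<in>\<^sub>M A \<Longrightarrow> F x \<in>\<^sub>M B"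
    "\<And>x y. x \<in>\<^sub>M A \<Longrightarrow> y \<in>\<^sub>M A \<Longrightarrow> F x = F y \<Longrightarrow> x = y"
proof -
  obtain f where f: "is_function mem f A B" "\<forall>a a' b. related mem f a b \<longrightarrow> related mem f a' b \<longrightarrow> a = a'"
    using assms unfolding card_le_def is_injection_def by auto
  show thesis
  proof (rule that)
    show "fdef (app f)" by (intro dfn_set_intros)
    show "app f x \<in>\<^sub>M B" if "x \<in>\<^sub>M A" for x using is_function_app[OF f(1) that] .
    show "x = y" if "x \<in>\<^sub>M A" "y \<in>\<^sub>M A" "app f x = app f y" for x y
      using f(2) that unfolding is_function_related[OF f(1)] by metis
  qed
qed

lemma card_eqI:
  assumes "fdef F" "\<And>x. x \<in>\<^sub>M A \<Longrightarrow> F x \<in>\<^sub>M B"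
    "\<And>x y. x \<in>\<^sub>M A \<Longrightarrow> y \<in>\<^sub>M A \<Longrightarrow> F x = F y \<Longrightarrow> x = y"
    "\<And>y. y \<in>\<^sub>M B \<Longrightarrow> \<exists>x. x \<in>\<^sub>M A \<and> y = F x"
  shows "card_eq mem A B"
  unfolding card_eq_def is_bijection_def is_injection_def
  using is_function_graph[OF assms(1,2)] assms(3,4)
  by (intro exI[of _ "graph A F"]) (auto simp: related_iff mem_graph[OF assms(1)])

lemma card_eqE:
  assumes "card_eq mem A B"
  obtains F where "fdef F" "\<And>x. x \<in>\<^sub>M A \<Longrightarrow> F x \<in>\<^sub>M B"
    "\<And>x y. x \<in>\<^sub>M A \<Longrightarrow> y \<in>\<^sub>M A \<Longrightarrow> F x = F y \<Longrightarrow> x = y"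
    "\<And>y. y \<in>\<^sub>M B \<Longrightarrow> \<exists>x. x \<in>\<^sub>M A \<and> y = F x"
proof -
  obtain f where f: "is_function mem f A B" "\<forall>a a' b. related mem f a b \<longrightarrow> related mem f a' b \<longrightarrow> a = a'"
    "\<forall>b. b \<in>\<^sub>M B \<longrightarrow> (\<exists>a. related mem f a b)"
    using assms unfolding card_eq_def is_bijection_def is_injection_def by auto
  show thesis
  proof (rule that)
    show "fdef (app f)" by (intro dfn_set_intros)
    show "app f x \<in>\<^sub>M B" if "x \<in>\<^sub>M A" for x using is_function_app[OF f(1) that] .
    show "x = y" if "x \<in>\<^sub>M A" "y \<in>\<^sub>M A" "app f x = app f y" for x y
      using f(2) that unfolding is_function_related[OF f(1)] by metis
    show "\<exists>x. x \<in>\<^sub>M A \<and> y = app f x" if "y \<in>\<^sub>M B" for y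
      using f(3) that unfolding is_function_related[OF f(1)] by blast
  qed
qed

lemma Dfn_card_le: "dtm t \<Longrightarrow> dtm u \<Longrightarrow> Dfn (\<lambda>e. card_le mem (t e) (u e))"
  by (erule (1) Dfn_lift2[rotated])
    (unfold card_le_def is_injection_def is_function_def is_pair_iff, intro dfn_set_intros Dfn_related)

lemma card_le_refl: "card_le mem A A"
  by (rule card_leI[of "\<lambda>x. x"]) (auto intro: dfn_intros)

lemma subset_card_le: "(\<And>x. x \<in>\<^sub>M A \<Longrightarrow> x \<in>\<^sub>M B) \<Longrightarrow> card_le mem A B"
  by (rule card_leI[of "\<lambda>x. x"]) (auto intro: dfn_intros)

lemma card_le_trans:
  assumes "card_le mem A B" "card_le mem B C" shows "card_le mem A C"
proof -
  obtain F where F: "fdef F" "\<And>x. x \<in>\<^sub>M A \<Longrightarrow> F x \<in>\<^sub>M B"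
    "\<And>x y. x \<in>\<^sub>M A \<Longrightarrow> y \<in>\<^sub>M A \<Longrightarrow> F x = F y \<Longrightarrow> x = y"
    using assms(1) by (rule card_leE) blast
  obtain G where G: "fdef G" "\<And>x. x \<in>\<^sub>M B \<Longrightarrow> G x \<in>\<^sub>M C"
    "\<And>x y. x \<in>\<^sub>M B \<Longrightarrow> y \<in>\<^sub>M B \<Longrightarrow> G x = G y \<Longrightarrow> x = y"
    using assms(2) by (rule card_leE) blast
  show ?thesis
  proof (rule card_leI[of "\<lambda>x. G (F x)"])
    show "fdef (\<lambda>x. G (F x))" by (rule dtm_lift1[OF G(1) F(1)])
    show "G (F x) \<in>\<^sub>M C" if "x \<in>\<^sub>M A" for x using that F(2) G(2) by blast
    show "x = y" if "x \<in>\<^sub>M A" "y \<in>\<^sub>M A" "G (F x) = G (F y)" for x y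
      using that F(2,3) G(3) by blast
  qed
qed

lemma card_eq_sym:
  assumes "card_eq mem A B" shows "card_eq mem B A"
proof -
  obtain F where F: "fdef F" "\<And>x. x \<in>\<^sub>M A \<Longrightarrow> F x \<in>\<^sub>M B"
    "\<And>x y. x \<in>\<^sub>M A \<Longrightarrow> y \<in>\<^sub>M A \<Longrightarrow> F x = F y \<Longrightarrow> x = y"
    "\<And>y. y \<in>\<^sub>M B \<Longrightarrow> \<exists>x. x \<in>\<^sub>M A \<and> y = F x"
    using assms by (rule card_eqE) blast
  define G where "G y = descr (\<lambda>x. x \<in>\<^sub>M A \<and> F x = y)" for y
  have G: "G (F x) = x" if "x \<in>\<^sub>M A" for x
    unfolding G_def by (rule descr_eq) (use that F(3) in auto)
  have "fdef G" unfolding G_def by (intro dfn_intros dtm_lift1[OF F(1)])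
  then show ?thesis
    by (rule card_eqI) (use F G in \<open>auto dest!: F(4), metis\<close>)
qed

lemma card_eq_trans:
  assumes "card_eq mem A B" "card_eq mem B C" shows "card_eq mem A C"
proof -
  obtain F where F: "fdef F" "\<And>x. x \<in>\<^sub>M A \<Longrightarrow> F x \<in>\<^sub>M B"
    "\<And>x y. x \<in>\<^sub>M A \<Longrightarrow> y \<in>\<^sub>M A \<Longrightarrow> F x = F y \<Longrightarrow> x = y"
    "\<And>y. y \<in>\<^sub>M B \<Longrightarrow> \<exists>x. x \<in>\<^sub>M A \<and> y = F x"
    using assms(1) by (rule card_eqE) blast
  obtain G where G: "fdef G" "\<And>x. x \<in>\<^sub>M B \<Longrightarrow> G x \<in>\<^sub>M C"
    "\<And>x y. x \<in>\<^sub>M B \<Longrightarrow> y \<in>\<^sub>M B \<Longrightarrow> G x = G y \<Longrightarrow> x = y"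
    "\<And>y. y \<in>\<^sub>M C \<Longrightarrow> \<exists>x. x \<in>\<^sub>M B \<and> y = G x"
    using assms(2) by (rule card_eqE) blast
  show ?thesis
  proof (rule card_eqI[of "\<lambda>x. G (F x)"])
    show "fdef (\<lambda>x. G (F x))" by (rule dtm_lift1[OF G(1) F(1)])
    show "G (F x) \<in>\<^sub>M C" if "x \<in>\<^sub>M A" for x using that F(2) G(2) by blast
    show "x = y" if "x \<in>\<^sub>M A" "y \<in>\<^sub>M A" "G (F x) = G (F y)" for x y
      using that F(2,3) G(3) by blast
    show "\<exists>x. x \<in>\<^sub>M A \<and> y = G (F x)" if "y \<in>\<^sub>M C" for y
      using G(4)[OF that] F(4) by metis
  qed
qed

lemma card_eq_refl: "card_eq mem A A"
  by (rule card_eqI[of "\<lambda>x. x"]) (auto intro: dfn_intros)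

lemma card_eq_le: "card_eq mem A B \<Longrightarrow> card_le mem A B"
  unfolding card_eq_def card_le_def is_bijection_def by blast

subsection \<open>Ordinals\<close>

text \<open>Foundation speaks of sets; separation extends it to definable predicates.\<close>

lemma eps_min:
  assumes "dfn1 P" "x \<in>\<^sub>M A" "P x"
  obtains y where "y \<in>\<^sub>M A" "P y" "\<And>z. z \<in>\<^sub>M y \<Longrightarrow> z \<in>\<^sub>M A \<Longrightarrow> \<not> P z"
  using foundation[of x "sep A P"] assms by (auto simp: mem_sep)

lemma mem_irrefl: "\<not> x \<in>\<^sub>M x"
  using foundation[of x "upair x x"] by auto

lemma mem_asym: "x \<in>\<^sub>M y \<Longrightarrow> \<not> y \<in>\<^sub>M x"
  using foundation[of x "upair x y"] by auto

lemma mem_no_3cycle: "x \<in>\<^sub>M y \<Longrightarrow> y \<in>\<^sub>M z \<Longrightarrow> \<not> z \<in>\<^sub>M x"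
  using foundation[of x "un (upair x y) (upair z z)"] by auto

text \<open>Foundation supplies the rest of the definition: it gives minimal elements, which
  linearity makes least, and it excludes membership cycles.\<close>

lemma ordinal_iff: "ordinal mem a \<longleftrightarrow> (\<forall>x y. x \<in>\<^sub>M a \<longrightarrow> y \<in>\<^sub>M x \<longrightarrow> y \<in>\<^sub>M a) \<and>
   (\<forall>x y. x \<in>\<^sub>M a \<longrightarrow> y \<in>\<^sub>M a \<longrightarrow> x \<in>\<^sub>M y \<or> x = y \<or> y \<in>\<^sub>M x)" (is "_ \<longleftrightarrow> ?T \<and> ?L")
proof
  assume "ordinal mem a"
  then show "?T \<and> ?L"
    unfolding ordinal_def M_subset_def strict_well_order_def strict_linear_order_def by blast
next
  assume *: "?T \<and> ?L"
  have "\<exists>m. m \<in>\<^sub>M S \<and> (\<forall>x. x \<in>\<^sub>M S \<longrightarrow> m = x \<or> m \<in>\<^sub>M x)"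
    if S: "M_subset mem S a" "\<not> is_empty mem S" for S
  proof -
    obtain m where m: "m \<in>\<^sub>M S" "\<not> (\<exists>z. z \<in>\<^sub>M S \<and> z \<in>\<^sub>M m)"
      using S(2) foundation[of _ S] unfolding is_empty_def by blast
    then show ?thesis using * S(1) unfolding M_subset_def by metis
  qed
  \<comment> \<open>Compare \<open>x\<close> and \<open>z\<close> by linearity: \<open>x = z\<close>
    would give a cycle of length two, and \<open>z \<in>\<^sub>M x\<close> one of length
    three.\<close>
  moreover have tr: "x \<in>\<^sub>M z" if "x \<in>\<^sub>M a" "z \<in>\<^sub>M a" "x \<in>\<^sub>M y" "y \<in>\<^sub>M z" for x y z
    using * that mem_no_3cycle mem_asym by metis
  then have "strict_linear_order mem a (\<in>\<^sub>M)"
    using * mem_irrefl unfolding strict_linear_order_def by blast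
  moreover have "\<forall>x. x \<in>\<^sub>M a \<longrightarrow> M_subset mem x a" using * unfolding M_subset_def by blast
  ultimately show "ordinal mem a"
    unfolding ordinal_def strict_well_order_def by blast
qed

lemma ordinal_trans: "ordinal mem a \<Longrightarrow> x \<in>\<^sub>M a \<Longrightarrow> y \<in>\<^sub>M x \<Longrightarrow> y \<in>\<^sub>M a"
  unfolding ordinal_iff by blast

lemma ordinal_mem: "ordinal mem a \<Longrightarrow> x \<in>\<^sub>M a \<Longrightarrow> ordinal mem x"
  unfolding ordinal_iff using mem_no_3cycle mem_asym by metis

text \<open>The least \<open>x\<close> in \<open>a\<close> outside \<open>b\<close> is
  \<open>b\<close> itself: its members are in \<open>b\<close> by minimality, and a member of
  \<open>b\<close>, being comparable with \<open>x\<close>, can neither equal nor contain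
  \<open>x\<close>, because \<open>b\<close> is transitive.\<close>

lemma ordinal_subset:
  assumes "ordinal mem a" "\<And>x. x \<in>\<^sub>M b \<Longrightarrow> x \<in>\<^sub>M a" "\<And>x y. x \<in>\<^sub>M b \<Longrightarrow> y \<in>\<^sub>M x \<Longrightarrow> y \<in>\<^sub>M b"
  shows "b = a \<or> b \<in>\<^sub>M a"
proof (cases "\<exists>x. x \<in>\<^sub>M a \<and> \<not> x \<in>\<^sub>M b")
  case True
  then obtain x0 where x0: "x0 \<in>\<^sub>M a" "\<not> x0 \<in>\<^sub>M b" by blast
  have d: "dfn1 (\<lambda>x. \<not> x \<in>\<^sub>M b)" by (intro dfn_intros)
  obtain x where x: "x \<in>\<^sub>M a" "\<not> x \<in>\<^sub>M b" "\<And>z. z \<in>\<^sub>M x \<Longrightarrow> z \<in>\<^sub>M a \<Longrightarrow> \<not> \<not> z \<in>\<^sub>M b"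
    by (rule eps_min[OF d x0]) blast
  have "x = b"
  proof (rule extensionality, rule allI)
    fix z
    show "z \<in>\<^sub>M x \<longleftrightarrow> z \<in>\<^sub>M b"
      using x assms unfolding ordinal_iff by metis
  qed
  then show ?thesis using x by simp
next
  case False
  then have "b = a" using assms(2) by (intro extensionality) blast
  then show ?thesis by simp
qed

text \<open>The intersection \<open>c\<close> is a transitive subset of both ordinals. If it were a
  member of both, it would be a member of itself.\<close>

lemma ordinal_linear:
  assumes "ordinal mem a" "ordinal mem b"
  shows "a \<in>\<^sub>M b \<or> a = b \<or> b \<in>\<^sub>M a"
proof -
  define c where "c = sep a (\<lambda>x. x \<in>\<^sub>M b)"
  have c: "x \<in>\<^sub>M c \<longleftrightarrow> x \<in>\<^sub>M a \<and> x \<in>\<^sub>M b" for x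
    unfolding c_def by (rule mem_sep) (intro dfn_intros)
  have "c = a \<or> c \<in>\<^sub>M a" "c = b \<or> c \<in>\<^sub>M b"
    using assms c ordinal_trans by (intro ordinal_subset; blast)+
  then show ?thesis using c mem_irrefl by blast
qed

lemma ordinal_of_ordinals:
  "(\<And>x y. x \<in>\<^sub>M a \<Longrightarrow> y \<in>\<^sub>M x \<Longrightarrow> y \<in>\<^sub>M a) \<Longrightarrow> (\<And>x. x \<in>\<^sub>M a \<Longrightarrow> ordinal mem x) \<Longrightarrow> ordinal mem a"
  unfolding ordinal_iff[of a] using ordinal_linear by blast

lemma ordinal_succ: "ordinal mem a \<Longrightarrow> ordinal mem (succ a)"
  by (rule ordinal_of_ordinals) (auto dest: ordinal_mem ordinal_trans)

lemma ordinal_least: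
  assumes "dfn1 P" "ordinal mem a" "P a"
  obtains b where "ordinal mem b" "P b" "b = a \<or> b \<in>\<^sub>M a" "\<And>x. x \<in>\<^sub>M b \<Longrightarrow> \<not> P x"
proof -
  \<comment> \<open>Searching in \<open>succ a\<close> includes \<open>a\<close> itself among the
    candidates.\<close>
  obtain b where b: "b \<in>\<^sub>M succ a" "P b" "\<And>z. z \<in>\<^sub>M b \<Longrightarrow> z \<in>\<^sub>M succ a \<Longrightarrow> \<not> P z"
    using eps_min[OF assms(1), of a "succ a"] assms(3) by auto
  have o: "ordinal mem (succ a)" using ordinal_succ[OF assms(2)] .
  show thesis
  proof (rule that)
    show "ordinal mem b" using ordinal_mem[OF o b(1)] .
    show "P b" using b(2) .
    show "b = a \<or> b \<in>\<^sub>M a" using b(1) by auto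
    show "\<not> P x" if "x \<in>\<^sub>M b" for x using b(3)[OF that ordinal_trans[OF o b(1) that]] .
  qed
qed

subsection \<open>Natural numbers\<close>

definition omega :: 'a where "omega = setof (\<lambda>x. \<forall>w. is_inductive mem w \<longrightarrow> x \<in>\<^sub>M w)"

lemma is_empty_iff: "is_empty mem z \<longleftrightarrow> z = emp"
  unfolding is_empty_def by (auto intro: extensionality)

lemma is_succ_iff: "is_succ mem s a \<longleftrightarrow> s = succ a"
  unfolding is_succ_def by (auto intro: extensionality)

lemma is_inductive_iff: "is_inductive mem w \<longleftrightarrow> emp \<in>\<^sub>M w \<and> (\<forall>n. n \<in>\<^sub>M w \<longrightarrow> succ n \<in>\<^sub>M w)"
  unfolding is_inductive_def is_empty_iff is_succ_iff by auto

lemma mem_omega: "x \<in>\<^sub>M omega \<longleftrightarrow> (\<forall>w. is_inductive mem w \<longrightarrow> x \<in>\<^sub>M w)"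
proof -
  obtain w where w: "is_inductive mem w" using infinity ..
  have "dfn1 (\<lambda>x. \<forall>w. is_inductive mem w \<longrightarrow> x \<in>\<^sub>M w)"
    unfolding is_inductive_iff by (intro dfn_set_intros)
  from separation_dfn[OF this, of w] show ?thesis
    unfolding omega_def using w by (intro mem_setof) blast
qed

lemma emp_omega: "emp \<in>\<^sub>M omega"
  unfolding mem_omega is_inductive_iff by blast

lemma succ_omega: "n \<in>\<^sub>M omega \<Longrightarrow> succ n \<in>\<^sub>M omega"
  unfolding mem_omega is_inductive_iff by blast

text \<open>The set \<open>sep omega P\<close> has to exist in the structure, so induction is tied
  to definable \<open>P\<close>, and the case \<open>def\<close> carries that obligation. If
  \<open>omega\<close> is nonstandard, induction over all HOL predicates is false.\<close>

lemma omega_induct [consumes 1, case_names def zero succ]: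
  assumes "n \<in>\<^sub>M omega" and d: "dfn1 P" and "P emp" "\<And>n. n \<in>\<^sub>M omega \<Longrightarrow> P n \<Longrightarrow> P (succ n)"
  shows "P n"
proof -
  have "is_inductive mem (sep omega P)"
    unfolding is_inductive_iff mem_sep[OF d] using assms emp_omega succ_omega by blast
  then show ?thesis using assms(1) mem_sep[OF d] mem_omega by blast
qed

lemma is_omega_iff: "is_omega mem w \<longleftrightarrow> w = omega"
proof -
  have "is_inductive mem omega" unfolding is_inductive_iff using emp_omega succ_omega by blast
  then show ?thesis
    unfolding is_omega_def M_subset_def by (metis extensionality mem_omega)
qed

lemma ordinal_emp: "ordinal mem emp"
  by (rule ordinal_of_ordinals) auto

lemma Dfn_ordinal: "dtm t \<Longrightarrow> Dfn (\<lambda>e. ordinal mem (t e))"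
  by (erule Dfn_lift1[rotated]) (unfold ordinal_iff, intro dfn_set_intros)

lemma ordinal_nat: "n \<in>\<^sub>M omega \<Longrightarrow> ordinal mem n"
  by (induction rule: omega_induct)
    (auto intro: ordinal_emp ordinal_succ dfn_set_intros Dfn_ordinal)

lemma ordinal_omega: "ordinal mem omega"
proof (rule ordinal_of_ordinals[OF _ ordinal_nat])
  show "y \<in>\<^sub>M omega" if "x \<in>\<^sub>M omega" "y \<in>\<^sub>M x" for x y
  proof -
    from that(1) have "\<forall>y. y \<in>\<^sub>M x \<longrightarrow> y \<in>\<^sub>M omega"
    proof (induction rule: omega_induct)
      case def
      show ?case by (intro dfn_set_intros)
    qed auto
    with that show ?thesis by blast
  qed
qed

lemma succ_inj: "succ a = succ b \<Longrightarrow> a = b"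
  using mem_succ[of a b] mem_succ[of b a] mem_succ[of a a] mem_succ[of b b] mem_asym[of a b] by metis

lemma omega_not_le_nat: "n \<in>\<^sub>M omega \<Longrightarrow> \<not> card_le mem omega n"
proof (induction rule: omega_induct)
  case def
  show ?case by (intro dfn_set_intros Dfn_card_le)
next
  case zero
  show ?case using emp_omega by (auto elim!: card_leE)
next
  case (succ n)
  show ?case
  proof
    assume "card_le mem omega (succ n)"
    then obtain F where F: "fdef F" "\<And>x. x \<in>\<^sub>M omega \<Longrightarrow> F x \<in>\<^sub>M succ n"
      "\<And>x y. x \<in>\<^sub>M omega \<Longrightarrow> y \<in>\<^sub>M omega \<Longrightarrow> F x = F y \<Longrightarrow> x = y"
      by (rule card_leE) blast
    have ne: "succ x \<noteq> emp" for x using mem_succ mem_emp by metis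
    define G where "G x = (if F (succ x) = n then F emp else F (succ x))" for x
    have "fdef G" unfolding G_def by (intro dfn_set_intros dtm_lift1[OF F(1)])
    then have "card_le mem omega n"
    proof (rule card_leI)
      show "G x \<in>\<^sub>M n" if x: "x \<in>\<^sub>M omega" for x
        using F(2)[OF emp_omega] F(2)[OF succ_omega[OF x]] F(3)[OF emp_omega succ_omega[OF x]] ne[of x]
        by (auto simp: G_def)
      show "x = y" if x: "x \<in>\<^sub>M omega" and y: "y \<in>\<^sub>M omega" and "G x = G y" for x y
        using that(3) F(3)[OF emp_omega succ_omega[OF x]] F(3)[OF emp_omega succ_omega[OF y]]
          F(3)[OF succ_omega[OF x] succ_omega[OF y]] ne[of x] ne[of y] succ_inj[of x y]
        by (auto simp: G_def split: if_splits)
    qed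
    with succ show False by blast
  qed
qed

lemma M_finite_iff: "M_finite mem A \<longleftrightarrow> (\<exists>n. n \<in>\<^sub>M omega \<and> card_eq mem A n)"
  unfolding M_finite_def is_omega_iff by auto

lemma M_countable_iff: "M_countable mem A \<longleftrightarrow> card_eq mem A omega"
  unfolding M_countable_def is_omega_iff by auto

lemma is_aleph_omega: "is_aleph mem omega"
  unfolding is_aleph_def M_finite_iff
  using ordinal_omega omega_not_le_nat card_eq_le card_eq_sym by blast

section \<open>Well-orders and the first uncountable aleph\<close>

lemma strict_well_orderD:
  assumes "strict_well_order mem A L"
  shows "x \<in>\<^sub>M A \<Longrightarrow> \<not> L x x"
    and "x \<in>\<^sub>M A \<Longrightarrow> y \<in>\<^sub>M A \<Longrightarrow> z \<in>\<^sub>M A \<Longrightarrow> L x y \<Longrightarrow> L y z \<Longrightarrow> L x z"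
    and "x \<in>\<^sub>M A \<Longrightarrow> y \<in>\<^sub>M A \<Longrightarrow> L x y \<or> x = y \<or> L y x"
  using assms unfolding strict_well_order_def strict_linear_order_def by blast+

lemma strict_well_order_min:
  assumes "strict_well_order mem A L" "dfn1 P" "x \<in>\<^sub>M A" "P x"
  obtains m where "m \<in>\<^sub>M A" "P m" "\<And>y. y \<in>\<^sub>M A \<Longrightarrow> P y \<Longrightarrow> m = y \<or> L m y"
proof -
  have "M_subset mem (sep A P) A" "\<not> is_empty mem (sep A P)"
    using assms(3,4) unfolding M_subset_def is_empty_def mem_sep[OF assms(2)] by blast+
  then obtain m where "m \<in>\<^sub>M sep A P" "\<forall>y. y \<in>\<^sub>M sep A P \<longrightarrow> m = y \<or> L m y"
    using assms(1) unfolding strict_well_order_def by blast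
  then show thesis using that[of m] unfolding mem_sep[OF assms(2)] by blast
qed

lemma strict_well_order_induct [consumes 2, case_names def step]:
  assumes wo: "strict_well_order mem A L" and x: "x \<in>\<^sub>M A" and d: "dfn1 P"
    and step: "\<And>x. x \<in>\<^sub>M A \<Longrightarrow> (\<And>y. y \<in>\<^sub>M A \<Longrightarrow> L y x \<Longrightarrow> P y) \<Longrightarrow> P x"
  shows "P x"
proof (rule ccontr)
  assume nP: "\<not> P x"
  have "dfn1 (\<lambda>x. \<not> P x)" using d by (intro dfn_intros)
  then obtain m where m: "m \<in>\<^sub>M A" "\<not> P m" "\<And>y. y \<in>\<^sub>M A \<Longrightarrow> \<not> P y \<Longrightarrow> m = y \<or> L m y"
    using strict_well_order_min[where P = "\<lambda>x. \<not> P x", OF wo _ x nP] by blast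
  have "P y" if "y \<in>\<^sub>M A" "L y m" for y
    using m(3)[OF that(1)] that m(1) strict_well_orderD(1,2)[OF wo] by metis
  with step[OF m(1)] m(2) show False by blast
qed

lemma img_cong: "fdef F \<Longrightarrow> fdef G \<Longrightarrow> (\<And>x. x \<in>\<^sub>M A \<Longrightarrow> F x = G x) \<Longrightarrow> img A F = img A G"
  by (rule extensionality) (auto simp: mem_img)

text \<open>The Mostowski collapse of a well-order. The recursion is carried out in the structure,
  by sets approximating the solution, because the result has to be a definable map.\<close>

lemma collapse:
  assumes wo: "strict_well_order mem A L" and L: "dfn2 L"
  obtains c where "fdef c" "\<And>x v. x \<in>\<^sub>M A \<Longrightarrow> v \<in>\<^sub>M c x \<longleftrightarrow> (\<exists>y. y \<in>\<^sub>M A \<and> L y x \<and> v = c y)"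
proof -
  \<comment> \<open>\<open>att f x\<close> says that \<open>f\<close> is an attempt at the recursion \<open>c z = {c y | y < z}\<close> up to \<open>x\<close>.\<close>
  define seg where "seg x = sep A (\<lambda>y. L y x)" for x
  have mem_seg: "y \<in>\<^sub>M seg x \<longleftrightarrow> y \<in>\<^sub>M A \<and> L y x" for x y
    unfolding seg_def by (intro mem_sep Dfn_lift2[OF L] dfn_intros)
  have seg: "fdef seg" unfolding seg_def by (intro dfn_set_intros Dfn_lift2[OF L])
  define att where "att f x \<longleftrightarrow>
    (\<forall>z. z \<in>\<^sub>M A \<longrightarrow> z = x \<or> L z x \<longrightarrow> app f z = img (seg z) (app f))" for f x
  have att: "dfn2 att"
    unfolding att_def by (intro dfn_set_intros Dfn_lift2[OF L] dtm_lift1[OF seg])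
  have app: "fdef (app f)" for f by (intro dfn_set_intros)
  have trans: "L y z \<Longrightarrow> z = x \<or> L z x \<Longrightarrow> L y x" if "x \<in>\<^sub>M A" "y \<in>\<^sub>M A" "z \<in>\<^sub>M A" for x y z
    using strict_well_orderD(2)[OF wo] that by blast
  have uniq: "app f z = app g z"
    if x: "x \<in>\<^sub>M A" "att f x" "att g x" and z: "z \<in>\<^sub>M A" "z = x \<or> L z x" for f g x z
  proof -
    from wo z(1) have "z = x \<or> L z x \<longrightarrow> app f z = app g z"
    proof (induction rule: strict_well_order_induct)
      case def
      show ?case by (intro dfn_set_intros Dfn_lift2[OF L])
    next
      case (step z)
      show ?case
      proof
        assume zx: "z = x \<or> L z x"
        have "app f z = img (seg z) (app f)" using x(2) step(1) zx unfolding att_def by blast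
        also have "\<dots> = img (seg z) (app g)"
        proof (rule img_cong[OF app app])
          fix y assume "y \<in>\<^sub>M seg z"
          then have y: "y \<in>\<^sub>M A" "L y z" unfolding mem_seg by blast+
          with step(2)[OF y] trans[OF x(1) y(1) step(1) y(2) zx] show "app f y = app g y" by blast
        qed
        also have "\<dots> = app g z" using x(3) step(1) zx unfolding att_def by metis
        finally show "app f z = app g z" .
      qed
    qed
    with z show ?thesis by blast
  qed
  \<comment> \<open>Any two attempts reaching \<open>x\<close> agree there, so the description has
    at most one candidate, and it has one as soon as some attempt exists.\<close>
  define c where "c x = descr (\<lambda>v. \<exists>f. att f x \<and> v = app f x)" for x
  have c: "fdef c" unfolding c_def by (intro dfn_set_intros Dfn_lift2[OF att])
  have c_app: "c x = app f x" if "x \<in>\<^sub>M A" "att f x" for x f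
    unfolding c_def by (rule descr_eq) (use that uniq in blast)+
  have att_below: "att f z" if "x \<in>\<^sub>M A" "att f x" "z \<in>\<^sub>M A" "L z x" for f x z
    using that trans[of x _ z] unfolding att_def by blast
  have rec_if: "c x = img (seg x) c" if x: "x \<in>\<^sub>M A" "att f x" for x f
  proof -
    have "c x = img (seg x) (app f)" using c_app[OF x] x unfolding att_def by simp
    also have "\<dots> = img (seg x) c"
    proof (rule img_cong[OF app c])
      fix y assume "y \<in>\<^sub>M seg x"
      then have y: "y \<in>\<^sub>M A" "L y x" unfolding mem_seg by blast+
      show "app f y = c y" using c_app[OF y(1) att_below[OF x y]] by simp
    qed
    finally show ?thesis .
  qed
  have "\<exists>f. att f x" if "x \<in>\<^sub>M A" for x
    using wo that
  proof (induction rule: strict_well_order_induct)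
    case def
    show ?case by (intro dfn_set_intros Dfn_lift2[OF att])
  next
    case (step x)
    \<comment> \<open>The attempt at \<open>x\<close> arises by unfolding \<open>c\<close> once
      more; below \<open>x\<close> the recursion equation for \<open>c\<close> is already known from
      the induction hypothesis.\<close>
    define G where "G z = img (seg z) c" for z
    have G: "fdef G" unfolding G_def by (intro dfn_set_intros dtm_lift1[OF c] dtm_lift1[OF seg])
    have cG: "c y = G y" if "y \<in>\<^sub>M A" "L y x" for y
      using step(2)[OF that] rec_if[OF that(1)] unfolding G_def by blast
    define f where "f = graph (sep A (\<lambda>z. z = x \<or> L z x)) G"
    have d: "dfn1 (\<lambda>z. z = x \<or> L z x)" by (intro dfn_set_intros Dfn_lift2[OF L])
    have f: "app f z = G z" if "z \<in>\<^sub>M A" "z = x \<or> L z x" for z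
      unfolding f_def by (rule app_graph[OF G]) (use that mem_sep[OF d] in blast)
    have "att f x"
      unfolding att_def
    proof (intro allI impI)
      fix z assume z: "z \<in>\<^sub>M A" "z = x \<or> L z x"
      have "img (seg z) c = img (seg z) (app f)"
      proof (rule img_cong[OF c app])
        fix y assume "y \<in>\<^sub>M seg z"
        then have y: "y \<in>\<^sub>M A" "L y z" unfolding mem_seg by blast+
        have "L y x" using trans[OF step(1) y(1) z(1) y(2) z(2)] .
        then show "c y = app f y" using cG[OF y(1)] f[OF y(1)] by simp
      qed
      then show "app f z = img (seg z) (app f)" using f[OF z] unfolding G_def by simp
    qed
    then show ?case by blast
  qed
  then have "c x = img (seg x) c" if "x \<in>\<^sub>M A" for x using rec_if that by blast
  then have "v \<in>\<^sub>M c x \<longleftrightarrow> (\<exists>y. y \<in>\<^sub>M A \<and> L y x \<and> v = c y)" if "x \<in>\<^sub>M A" for x v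
    using that mem_img[OF c] mem_seg by metis
  with c show thesis by (rule that)
qed

text \<open>The collapse turns \<open>L\<close> into membership. As membership is irreflexive and
  \<open>L\<close> is linear, the collapse is injective and its range is linearly ordered by
  membership.\<close>

lemma order_type:
  assumes wo: "strict_well_order mem A L" and L: "dfn2 L"
  obtains c a where "fdef c" "ordinal mem a" "\<And>v. v \<in>\<^sub>M a \<longleftrightarrow> (\<exists>x. x \<in>\<^sub>M A \<and> v = c x)"
    "\<And>x v. x \<in>\<^sub>M A \<Longrightarrow> v \<in>\<^sub>M c x \<longleftrightarrow> (\<exists>y. y \<in>\<^sub>M A \<and> L y x \<and> v = c y)"
    "\<And>x y. x \<in>\<^sub>M A \<Longrightarrow> y \<in>\<^sub>M A \<Longrightarrow> c x = c y \<Longrightarrow> x = y"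
    "card_eq mem A a"
proof -
  obtain c where c: "fdef c"
    "\<And>x v. x \<in>\<^sub>M A \<Longrightarrow> v \<in>\<^sub>M c x \<longleftrightarrow> (\<exists>y. y \<in>\<^sub>M A \<and> L y x \<and> v = c y)"
    using collapse[OF assms] by blast
  have a: "v \<in>\<^sub>M img A c \<longleftrightarrow> (\<exists>x. x \<in>\<^sub>M A \<and> v = c x)" for v by (rule mem_img[OF c(1)])
  have mono: "c x \<in>\<^sub>M c y" if "x \<in>\<^sub>M A" "y \<in>\<^sub>M A" "L x y" for x y
    using c(2) that by blast
  have inj: "x = y" if "x \<in>\<^sub>M A" "y \<in>\<^sub>M A" "c x = c y" for x y
    using strict_well_orderD(3)[OF wo that(1,2)] mono[of x y] mono[of y x] that mem_irrefl by metis
  have ord: "ordinal mem (img A c)"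
    unfolding ordinal_iff
  proof (intro conjI allI impI)
    fix v w assume "v \<in>\<^sub>M img A c"
    { assume "w \<in>\<^sub>M v"
      then show "w \<in>\<^sub>M img A c" using \<open>v \<in>\<^sub>M img A c\<close> a c(2) by metis }
    { assume "w \<in>\<^sub>M img A c"
      then show "v \<in>\<^sub>M w \<or> v = w \<or> w \<in>\<^sub>M v"
        using \<open>v \<in>\<^sub>M img A c\<close> a mono strict_well_orderD(3)[OF wo] by metis }
  qed
  have "card_eq mem A (img A c)" by (rule card_eqI[OF c(1)]) (use a inj in auto)
  with that[of c "img A c"] c ord a inj show thesis by blast
qed

lemma ordinal_strict_well_order:
  assumes "ordinal mem k" "\<And>x. x \<in>\<^sub>M S \<Longrightarrow> x \<in>\<^sub>M k"
  shows "strict_well_order mem S (\<in>\<^sub>M)"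
proof -
  have wo: "strict_well_order mem k (\<in>\<^sub>M)" using assms(1) unfolding ordinal_def by blast
  have "M_subset mem T k" if "M_subset mem T S" for T
    using that assms(2) unfolding M_subset_def by blast
  moreover have "strict_linear_order mem S (\<in>\<^sub>M)"
    unfolding strict_linear_order_def using strict_well_orderD[OF wo] assms(2) by metis
  ultimately show ?thesis using wo unfolding strict_well_order_def by blast
qed

text \<open>The collapse of a set of ordinals moves nothing upwards, by induction along the order.
  So the order type consists of elements of \<open>k\<close> and is at most
  \<open>k\<close>.\<close>

lemma subset_ordinal:
  assumes k: "ordinal mem k" and S: "\<And>x. x \<in>\<^sub>M S \<Longrightarrow> x \<in>\<^sub>M k"
  obtains a where "ordinal mem a" "card_eq mem S a" "a = k \<or> a \<in>\<^sub>M k"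
proof -
  have wo: "strict_well_order mem S (\<in>\<^sub>M)" using ordinal_strict_well_order[OF assms] .
  have L: "dfn2 (\<in>\<^sub>M)" by (intro dfn_intros)
  obtain c a where c: "fdef c" "ordinal mem a" "\<And>v. v \<in>\<^sub>M a \<longleftrightarrow> (\<exists>x. x \<in>\<^sub>M S \<and> v = c x)"
    "\<And>x v. x \<in>\<^sub>M S \<Longrightarrow> v \<in>\<^sub>M c x \<longleftrightarrow> (\<exists>y. y \<in>\<^sub>M S \<and> y \<in>\<^sub>M x \<and> v = c y)"
    "card_eq mem S a"
    by (rule order_type[OF wo L]) blast
  have "c x = x \<or> c x \<in>\<^sub>M x" if "x \<in>\<^sub>M S" for x
    using wo that
  proof (induction rule: strict_well_order_induct)
    case def
    show ?case by (intro dfn_intros dtm_lift1[OF c(1)])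
  next
    case (step x)
    have x: "ordinal mem x" using k S step(1) ordinal_mem by blast
    show ?case
    proof (rule ordinal_subset[OF x])
      show "v \<in>\<^sub>M x" if "v \<in>\<^sub>M c x" for v
        using that c(4)[OF step(1)] step(2) x ordinal_trans by metis
      have "ordinal mem (c x)" using c(2,3) step(1) ordinal_mem by blast
      then show "w \<in>\<^sub>M c x" if "v \<in>\<^sub>M c x" "w \<in>\<^sub>M v" for v w using that ordinal_trans by blast
    qed
  qed
  then have "v \<in>\<^sub>M k" if "v \<in>\<^sub>M a" for v
    using that c(3) S ordinal_trans[OF k] by metis
  then have "a = k \<or> a \<in>\<^sub>M k" using ordinal_subset[OF k] ordinal_trans[OF c(2)] by blast
  with c that show thesis by blast
qed

lemma card_le_ordinal:
  assumes "ordinal mem k" "card_le mem A k"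
  obtains a where "ordinal mem a" "card_eq mem A a" "a = k \<or> a \<in>\<^sub>M k"
proof -
  obtain F where F: "fdef F" "\<And>x. x \<in>\<^sub>M A \<Longrightarrow> F x \<in>\<^sub>M k"
    "\<And>x y. x \<in>\<^sub>M A \<Longrightarrow> y \<in>\<^sub>M A \<Longrightarrow> F x = F y \<Longrightarrow> x = y"
    using assms(2) by (rule card_leE) blast
  have S: "x \<in>\<^sub>M k" if "x \<in>\<^sub>M img A F" for x using that F(2) by (auto simp: mem_img[OF F(1)])
  obtain a where a: "ordinal mem a" "card_eq mem (img A F) a" "a = k \<or> a \<in>\<^sub>M k"
    by (rule subset_ordinal[OF assms(1) S])
  have "card_eq mem A (img A F)" by (rule card_eqI[OF F(1)]) (use F(3) mem_img[OF F(1)] in auto)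
  then show thesis using that a card_eq_trans by blast
qed

section \<open>Countable sets and the first uncountable aleph\<close>

lemma nat_card_le_omega: "n \<in>\<^sub>M omega \<Longrightarrow> card_le mem n omega"
  using ordinal_trans[OF ordinal_omega] by (intro subset_card_le)

text \<open>A set injecting into \<open>omega\<close> is equinumerous with an ordinal that is
  \<open>omega\<close> or one of its members, the natural numbers.\<close>

lemma large_iff: "large mem A \<longleftrightarrow> \<not> card_le mem A omega"
proof -
  have "M_finite mem A \<or> M_countable mem A" if le: "card_le mem A omega"
    by (rule card_le_ordinal[OF ordinal_omega le]) (auto simp: M_finite_iff M_countable_iff)
  moreover have "card_le mem A omega" if "M_finite mem A \<or> M_countable mem A"
    using that nat_card_le_omega card_eq_le card_le_trans unfolding M_finite_iff M_countable_iff
    by blast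
  ultimately show ?thesis unfolding large_def by blast
qed

text \<open>The case of the Schroeder-Bernstein theorem at \<open>omega\<close>: the first
  inequality leaves finite or countable, and the second excludes finite.\<close>

lemma card_eq_omegaI:
  assumes "card_le mem A omega" "card_le mem omega A" shows "card_eq mem A omega"
  using assms large_iff omega_not_le_nat card_eq_le card_le_trans
  unfolding large_def M_finite_iff M_countable_iff by blast

lemma is_aleph_1_iff: "is_aleph_1 mem k \<longleftrightarrow> is_aleph mem k \<and> omega \<in>\<^sub>M k \<and>
    (\<forall>l. is_aleph mem l \<longrightarrow> omega \<in>\<^sub>M l \<longrightarrow> l = k \<or> k \<in>\<^sub>M l)"
  unfolding is_aleph_1_def is_omega_iff by blast

lemma aleph_large: "is_aleph mem k \<Longrightarrow> omega \<in>\<^sub>M k \<Longrightarrow> \<not> card_le mem k omega"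
  using large_iff[of k] card_eq_sym unfolding is_aleph_def large_def M_countable_iff by blast

lemma is_aleph_1I:
  assumes b: "ordinal mem b" "\<not> card_le mem b omega" "\<And>x. x \<in>\<^sub>M b \<Longrightarrow> card_le mem x omega"
  shows "is_aleph_1 mem b"
  unfolding is_aleph_1_iff
proof (intro conjI allI impI)
  show "is_aleph mem b"
    unfolding is_aleph_def
    using b card_eq_sym card_eq_le card_le_trans large_iff[of b] unfolding large_def by blast
  show "omega \<in>\<^sub>M b"
    using ordinal_linear[OF b(1) ordinal_omega] b(2) nat_card_le_omega card_le_refl by blast
  fix l assume l: "is_aleph mem l" "omega \<in>\<^sub>M l"
  then have "\<not> card_le mem l omega" by (rule aleph_large)
  then have "\<not> l \<in>\<^sub>M b" using b(3) by blast
  then show "l = b \<or> b \<in>\<^sub>M l" using ordinal_linear[of l b] l b(1) unfolding is_aleph_def by blast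
qed

text \<open>The ordinal \<open>a\<close> bounds the search; the least ordinal up to it that does not
  inject into \<open>omega\<close> has only members that do.\<close>

lemma ex_aleph_1:
  assumes "ordinal mem a" "\<not> card_le mem a omega"
  obtains k where "is_aleph_1 mem k" "k = a \<or> k \<in>\<^sub>M a"
proof -
  have d: "dfn1 (\<lambda>x. \<not> card_le mem x omega)" by (intro dfn_intros Dfn_card_le)
  show thesis
    by (rule ordinal_least[OF d assms]) (use that is_aleph_1I in blast)
qed

text \<open>An uncountable member would have a first uncountable aleph at or below it, hence inside
  \<open>k\<close>, against the minimality of \<open>k\<close>.\<close>

lemma mem_aleph_1: "card_le mem a omega" if k: "is_aleph_1 mem k" and a: "a \<in>\<^sub>M k"
proof (rule ccontr)
  assume *: "\<not> card_le mem a omega"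
  have ok: "ordinal mem k" using k unfolding is_aleph_1_iff is_aleph_def by blast
  obtain b where b: "is_aleph_1 mem b" "b = a \<or> b \<in>\<^sub>M a"
    using ex_aleph_1[OF ordinal_mem[OF ok a] *] .
  then have "b \<in>\<^sub>M k" using a ordinal_trans[OF ok] by blast
  moreover have "b = k \<or> k \<in>\<^sub>M b" using k b(1) unfolding is_aleph_1_iff by blast
  ultimately show False using mem_irrefl mem_asym by blast
qed

text \<open>This turns the smallness condition in the definition of cofinality into
  countability.\<close>

lemma card_less_aleph_1:
  assumes k: "is_aleph_1 mem k"
  shows "card_less mem X k \<longleftrightarrow> card_le mem X omega"
proof
  have ok: "ordinal mem k" and nk: "\<not> card_le mem k omega" and wk: "omega \<in>\<^sub>M k"
    using k aleph_large unfolding is_aleph_1_iff is_aleph_def by blast+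
  show "card_le mem X omega" if X: "card_less mem X k"
  proof -
    obtain a where a: "card_eq mem X a" "a = k \<or> a \<in>\<^sub>M k"
      using card_le_ordinal[OF ok, of X] X unfolding card_less_def by blast
    then have "a \<in>\<^sub>M k" using X unfolding card_less_def by blast
    then show ?thesis using mem_aleph_1[OF k] a(1) card_eq_le card_le_trans by blast
  qed
  show "card_less mem X k" if "card_le mem X omega"
    using that nk card_eq_sym card_eq_le card_le_trans subset_card_le[OF ordinal_trans[OF ok wk]]
    unfolding card_less_def by blast
qed

text \<open>Instead of choosing a preimage of \<open>y\<close>, the proof codes \<open>y\<close> by
  the least of the numbers \<open>H x\<close>, where \<open>x\<close> ranges over its
  preimages.\<close>

lemma card_le_img_omega:
  assumes "card_le mem A omega" and F: "fdef F" shows "card_le mem (img A F) omega"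
proof -
  obtain H where H: "fdef H" "\<And>x. x \<in>\<^sub>M A \<Longrightarrow> H x \<in>\<^sub>M omega"
    "\<And>x y. x \<in>\<^sub>M A \<Longrightarrow> y \<in>\<^sub>M A \<Longrightarrow> H x = H y \<Longrightarrow> x = y"
    using assms(1) by (rule card_leE) blast
  define Q where "Q y n \<longleftrightarrow> (\<exists>x. x \<in>\<^sub>M A \<and> n = H x \<and> y = F x)" for y n
  have Q: "dfn2 Q" unfolding Q_def by (intro dfn_set_intros dtm_lift1[OF H(1)] dtm_lift1[OF F])
  define K where "K y = descr (\<lambda>n. Q y n \<and> (\<forall>m. m \<in>\<^sub>M n \<longrightarrow> \<not> Q y m))" for y
  have K: "fdef K" unfolding K_def by (intro dfn_set_intros Dfn_lift2[OF Q])
  have QK: "Q y (K y)" if y: "y \<in>\<^sub>M img A F" for y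
  proof -
    obtain x where x: "x \<in>\<^sub>M A" "y = F x" using y unfolding mem_img[OF F] by blast
    have d: "dfn1 (Q y)" by (intro Dfn_lift2[OF Q] dfn_intros)
    have ord: "ordinal mem n" if "Q y n" for n using that H(2) ordinal_nat unfolding Q_def by blast
    have Qx: "Q y (H x)" using x unfolding Q_def by blast
    obtain n where n: "Q y n" "\<And>m. m \<in>\<^sub>M n \<Longrightarrow> \<not> Q y m"
      by (rule ordinal_least[OF d ord[OF Qx] Qx]) blast
    have "K y = n"
      unfolding K_def by (rule descr_eq) (use n ordinal_linear ord in blast)+
    with n show ?thesis by simp
  qed
  have "K y \<in>\<^sub>M omega" if "y \<in>\<^sub>M img A F" for y using QK[OF that] H(2) unfolding Q_def by auto
  moreover have "y = z" if "y \<in>\<^sub>M img A F" "z \<in>\<^sub>M img A F" "K y = K z" for y z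
    using QK[OF that(1)] QK[OF that(2)] that(3) H(3) unfolding Q_def by metis
  ultimately show ?thesis by (rule card_leI[OF K])
qed

lemma well_orderable_card_le:
  assumes "card_le mem A k" "ordinal mem k" shows "well_orderable mem A"
proof -
  obtain G where G: "fdef G" "\<And>x. x \<in>\<^sub>M A \<Longrightarrow> G x \<in>\<^sub>M k"
    "\<And>x y. x \<in>\<^sub>M A \<Longrightarrow> y \<in>\<^sub>M A \<Longrightarrow> G x = G y \<Longrightarrow> x = y"
    using assms(1) by (rule card_leE) blast
  have wo: "strict_well_order mem k (\<in>\<^sub>M)" using assms(2) unfolding ordinal_def by blast
  define P where "P p \<longleftrightarrow> (\<exists>x y. x \<in>\<^sub>M A \<and> y \<in>\<^sub>M A \<and> p = pair x y \<and> G x \<in>\<^sub>M G y)" for p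
  have P: "dfn1 P" unfolding P_def by (intro dfn_set_intros dtm_lift1[OF G(1)])
  \<comment> \<open>A Kuratowski pair over \<open>A\<close> is a set of subsets of \<open>A\<close>,
    so the double power set contains all the pairs from which the order is separated.\<close>
  define r where "r = sep (pow (pow A)) P"
  have r: "related mem r x y \<longleftrightarrow> x \<in>\<^sub>M A \<and> y \<in>\<^sub>M A \<and> G x \<in>\<^sub>M G y" for x y
  proof -
    have "pair x y \<in>\<^sub>M pow (pow A)" if "x \<in>\<^sub>M A" "y \<in>\<^sub>M A"
      using that by (auto simp: M_subset_def pair_def)
    then show ?thesis unfolding related_iff r_def mem_sep[OF P] P_def by (auto simp del: mem_pow)
  qed
  have "strict_linear_order mem A (related mem r)"
    unfolding strict_linear_order_def r
  proof (intro conjI allI impI)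
    fix x y z assume "x \<in>\<^sub>M A" "y \<in>\<^sub>M A" "z \<in>\<^sub>M A"
      and "x \<in>\<^sub>M A \<and> y \<in>\<^sub>M A \<and> G x \<in>\<^sub>M G y" "y \<in>\<^sub>M A \<and> z \<in>\<^sub>M A \<and> G y \<in>\<^sub>M G z"
    then show "G x \<in>\<^sub>M G z" using strict_well_orderD(2)[OF wo G(2) G(2) G(2), of x y z] by blast
  next
    fix x y assume "x \<in>\<^sub>M A" "y \<in>\<^sub>M A"
    then show "x \<in>\<^sub>M A \<and> y \<in>\<^sub>M A \<and> G x \<in>\<^sub>M G y \<or> x = y \<or> y \<in>\<^sub>M A \<and> x \<in>\<^sub>M A \<and> G y \<in>\<^sub>M G x"
      using strict_well_orderD(3)[OF wo G(2) G(2), of x y] G(3)[of x y] by blast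
  qed (simp_all add: mem_irrefl)
  moreover have "\<exists>m. m \<in>\<^sub>M S \<and> (\<forall>x. x \<in>\<^sub>M S \<longrightarrow> m = x \<or> related mem r m x)"
    if S: "M_subset mem S A" "\<not> is_empty mem S" for S
  proof -
    have SA: "x \<in>\<^sub>M A" if "x \<in>\<^sub>M S" for x using that S(1) unfolding M_subset_def by blast
    obtain s where "s \<in>\<^sub>M S" using S(2) unfolding is_empty_def by blast
    then have "G s \<in>\<^sub>M img S G" using mem_img[OF G(1)] by blast
    then obtain v where v: "v \<in>\<^sub>M img S G" "\<not> (\<exists>z. z \<in>\<^sub>M img S G \<and> z \<in>\<^sub>M v)"
      using foundation by blast
    then obtain m where m: "m \<in>\<^sub>M S" "v = G m" using mem_img[OF G(1)] by blast
    have "m = x \<or> related mem r m x" if x: "x \<in>\<^sub>M S" for x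
    proof -
      have "G x \<in>\<^sub>M img S G" using x mem_img[OF G(1)] by blast
      then have "\<not> G x \<in>\<^sub>M G m" using v(2) m(2) by blast
      then show ?thesis
        unfolding r using strict_well_orderD(3)[OF wo G(2) G(2), OF SA SA, OF m(1) x] G(3) SA m(1) x
        by blast
    qed
    with m(1) show ?thesis by blast
  qed
  ultimately show ?thesis unfolding well_orderable_def strict_well_order_def by blast
qed

lemma aleph_omega_le: "is_aleph mem m \<Longrightarrow> m = omega \<or> omega \<in>\<^sub>M m"
  using ordinal_linear[OF _ ordinal_omega, of m] card_eq_refl[of m]
  unfolding is_aleph_def M_finite_iff by blast

end

section \<open>The real line\<close>

locale real_line = ZF_model mem for mem :: "'a \<Rightarrow> 'a \<Rightarrow> bool"  (infix "\<in>\<^sub>M" 50) +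
  fixes R add mul lt zero one :: 'a
  assumes field: "is_field mem R add mul zero one"
    and linear: "strict_linear_order mem R (related mem lt)"
    and add_mono: "x \<in>\<^sub>M R \<Longrightarrow> y \<in>\<^sub>M R \<Longrightarrow> z \<in>\<^sub>M R \<Longrightarrow> related mem lt x y \<Longrightarrow>
      related mem lt (app2 mem add x z) (app2 mem add y z)"
    and mul_mono: "x \<in>\<^sub>M R \<Longrightarrow> y \<in>\<^sub>M R \<Longrightarrow> related mem lt zero x \<Longrightarrow> related mem lt zero y \<Longrightarrow>
      related mem lt zero (app2 mem mul x y)"
    and complete: "M_subset mem S R \<Longrightarrow> \<not> is_empty mem S \<Longrightarrow> upper_bound mem R lt S u \<Longrightarrow>
      \<exists>u. upper_bound mem R lt S u \<and> (\<forall>v. upper_bound mem R lt S v \<longrightarrow> u = v \<or> related mem lt u v)"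
begin

text \<open>Unlike \<^const>\<open>app2\<close>, the operations below are definable also outside \<open>R\<close>.\<close>

definition plus (infixl "\<oplus>" 65) where "x \<oplus> y = descr (app2_rel mem add x y)"
definition times (infixl "\<otimes>" 70) where "x \<otimes> y = descr (app2_rel mem mul x y)"
abbreviation less (infix "\<sqsubset>" 50) where "x \<sqsubset> y \<equiv> related mem lt x y"
abbreviation less_eq (infix "\<sqsubseteq>" 50) where "x \<sqsubseteq> y \<equiv> x = y \<or> x \<sqsubset> y"

lemma Dfn_less: "dtm t \<Longrightarrow> dtm u \<Longrightarrow> Dfn (\<lambda>e. t e \<sqsubset> u e)"
  by (intro Dfn_related dfn_intros)

lemma dtm_plus: "dtm t \<Longrightarrow> dtm u \<Longrightarrow> dtm (\<lambda>e. t e \<oplus> u e)"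
  by (erule (1) dtm_lift2[rotated])
    (unfold plus_def app2_rel_def is_pair_iff, intro dfn_set_intros Dfn_related)

lemma dtm_times: "dtm t \<Longrightarrow> dtm u \<Longrightarrow> dtm (\<lambda>e. t e \<otimes> u e)"
  by (erule (1) dtm_lift2[rotated])
    (unfold times_def app2_rel_def is_pair_iff, intro dfn_set_intros Dfn_related)

lemma binop_closed:
  assumes f: "is_binop mem f R" and x: "x \<in>\<^sub>M R" and y: "y \<in>\<^sub>M R"
  shows "app2 mem f x y = descr (app2_rel mem f x y)" "descr (app2_rel mem f x y) \<in>\<^sub>M R"
proof -
  have ex1: "\<exists>!z. app2_rel mem f x y z" using f x y unfolding is_binop_def by blast
  then show "app2 mem f x y = descr (app2_rel mem f x y)" unfolding app2_def descr_def by simp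
  have "app2_rel mem f x y (descr (app2_rel mem f x y))"
    unfolding descr_def using ex1 by (simp add: theI')
  then have "pair (pair x y) (descr (app2_rel mem f x y)) \<in>\<^sub>M f"
    unfolding app2_rel_def related_iff by simp
  then show "descr (app2_rel mem f x y) \<in>\<^sub>M R"
    using f unfolding is_binop_def by (metis is_pair_iff pair_eq_iff)
qed

section \<open>Ordered field arithmetic\<close>

lemmas field_axioms = field[unfolded is_field_def]

lemma binops: "is_binop mem add R" "is_binop mem mul R"
  by (insert field_axioms) (elim conjE; assumption)+

lemma constants [simp]: "zero \<in>\<^sub>M R" "one \<in>\<^sub>M R" and zero_neq_one: "zero \<noteq> one"
  by (insert field_axioms) (elim conjE; assumption)+

lemmas app2_eq [simp] = binop_closed(1)[OF binops(1), folded plus_def]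
  binop_closed(1)[OF binops(2), folded times_def]

lemmas closed [simp] = binop_closed(2)[OF binops(1), folded plus_def]
  binop_closed(2)[OF binops(2), folded times_def]

lemma field_laws:
  "\<forall>x y z. x \<in>\<^sub>M R \<longrightarrow> y \<in>\<^sub>M R \<longrightarrow> z \<in>\<^sub>M R \<longrightarrow>
     app2 mem add (app2 mem add x y) z = app2 mem add x (app2 mem add y z) \<and>
     app2 mem mul (app2 mem mul x y) z = app2 mem mul x (app2 mem mul y z) \<and>
     app2 mem mul x (app2 mem add y z) = app2 mem add (app2 mem mul x y) (app2 mem mul x z)"
  "\<forall>x y. x \<in>\<^sub>M R \<longrightarrow> y \<in>\<^sub>M R \<longrightarrow>
     app2 mem add x y = app2 mem add y x \<and> app2 mem mul x y = app2 mem mul y x"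
  "\<forall>x. x \<in>\<^sub>M R \<longrightarrow> app2 mem add x zero = x \<and> app2 mem mul x one = x"
  "\<forall>x. x \<in>\<^sub>M R \<longrightarrow> (\<exists>y. y \<in>\<^sub>M R \<and> app2 mem add x y = zero)"
  "\<forall>x. x \<in>\<^sub>M R \<longrightarrow> x \<noteq> zero \<longrightarrow> (\<exists>y. y \<in>\<^sub>M R \<and> app2 mem mul x y = one)"
  by (insert field_axioms) (elim conjE; assumption)+

lemma add_assoc: "x \<in>\<^sub>M R \<Longrightarrow> y \<in>\<^sub>M R \<Longrightarrow> z \<in>\<^sub>M R \<Longrightarrow> x \<oplus> y \<oplus> z = x \<oplus> (y \<oplus> z)"
  and mul_assoc: "x \<in>\<^sub>M R \<Longrightarrow> y \<in>\<^sub>M R \<Longrightarrow> z \<in>\<^sub>M R \<Longrightarrow> x \<otimes> y \<otimes> z = x \<otimes> (y \<otimes> z)"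
  and distrib: "x \<in>\<^sub>M R \<Longrightarrow> y \<in>\<^sub>M R \<Longrightarrow> z \<in>\<^sub>M R \<Longrightarrow> x \<otimes> (y \<oplus> z) = x \<otimes> y \<oplus> x \<otimes> z"
  using field_laws(1)[rule_format, of x y z] by simp_all

lemma add_comm: "x \<in>\<^sub>M R \<Longrightarrow> y \<in>\<^sub>M R \<Longrightarrow> x \<oplus> y = y \<oplus> x"
  and mul_comm: "x \<in>\<^sub>M R \<Longrightarrow> y \<in>\<^sub>M R \<Longrightarrow> x \<otimes> y = y \<otimes> x"
  using field_laws(2)[rule_format, of x y] by simp_all

lemma neutral [simp]: "x \<in>\<^sub>M R \<Longrightarrow> x \<oplus> zero = x" "x \<in>\<^sub>M R \<Longrightarrow> x \<otimes> one = x"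
  using field_laws(3)[rule_format, of x] by simp_all

lemma neutral' [simp]: "x \<in>\<^sub>M R \<Longrightarrow> zero \<oplus> x = x" "x \<in>\<^sub>M R \<Longrightarrow> one \<otimes> x = x"
  using add_comm[of zero x] mul_comm[of one x] by simp_all

lemma ex_diff:
  assumes "x \<in>\<^sub>M R" "y \<in>\<^sub>M R" obtains d where "d \<in>\<^sub>M R" "x \<oplus> d = y"
proof -
  obtain n where n: "n \<in>\<^sub>M R" "app2 mem add x n = zero"
    using field_laws(4) assms by blast
  show thesis by (rule that[of "n \<oplus> y"]) (use n assms add_assoc[of x n y] in simp_all)
qed

lemma ex_inv:
  assumes "x \<in>\<^sub>M R" "x \<noteq> zero" obtains y where "y \<in>\<^sub>M R" "x \<otimes> y = one"
proof -
  obtain n where n: "n \<in>\<^sub>M R" "app2 mem mul x n = one"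
    using field_laws(5) assms by blast
  then show thesis using that[of n] assms by simp
qed

lemma less_irrefl: "x \<in>\<^sub>M R \<Longrightarrow> \<not> x \<sqsubset> x"
  and less_trans: "x \<in>\<^sub>M R \<Longrightarrow> y \<in>\<^sub>M R \<Longrightarrow> z \<in>\<^sub>M R \<Longrightarrow> x \<sqsubset> y \<Longrightarrow> y \<sqsubset> z \<Longrightarrow> x \<sqsubset> z"
  and less_linear: "x \<in>\<^sub>M R \<Longrightarrow> y \<in>\<^sub>M R \<Longrightarrow> x \<sqsubset> y \<or> x = y \<or> y \<sqsubset> x"
  using linear unfolding strict_linear_order_def by blast+

lemma less_asym: "x \<in>\<^sub>M R \<Longrightarrow> y \<in>\<^sub>M R \<Longrightarrow> x \<sqsubset> y \<Longrightarrow> \<not> y \<sqsubset> x"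
  using less_trans less_irrefl by blast

lemma add_less: "x \<in>\<^sub>M R \<Longrightarrow> y \<in>\<^sub>M R \<Longrightarrow> z \<in>\<^sub>M R \<Longrightarrow> x \<oplus> z \<sqsubset> y \<oplus> z \<longleftrightarrow> x \<sqsubset> y"
  using add_mono[of x y z] add_mono[of y x z] less_linear[of x y] less_asym[of "x \<oplus> z" "y \<oplus> z"]
    less_irrefl[of "x \<oplus> z"] by auto

lemma add_less': "x \<in>\<^sub>M R \<Longrightarrow> y \<in>\<^sub>M R \<Longrightarrow> z \<in>\<^sub>M R \<Longrightarrow> z \<oplus> x \<sqsubset> z \<oplus> y \<longleftrightarrow> x \<sqsubset> y"
  using add_less[of x y z] by (simp add: add_comm)

lemma add_cancel: "x \<in>\<^sub>M R \<Longrightarrow> y \<in>\<^sub>M R \<Longrightarrow> z \<in>\<^sub>M R \<Longrightarrow> x \<oplus> z = y \<oplus> z \<longleftrightarrow> x = y"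
  using add_less[of x y z] add_less[of y x z] less_linear[of x y] less_irrefl[of "x \<oplus> z"] by auto

lemma add_cancel': "x \<in>\<^sub>M R \<Longrightarrow> y \<in>\<^sub>M R \<Longrightarrow> z \<in>\<^sub>M R \<Longrightarrow> z \<oplus> x = z \<oplus> y \<longleftrightarrow> x = y"
  using add_cancel[of x y z] by (simp add: add_comm)

lemma less_add_iff: "x \<in>\<^sub>M R \<Longrightarrow> d \<in>\<^sub>M R \<Longrightarrow> x \<sqsubset> x \<oplus> d \<longleftrightarrow> zero \<sqsubset> d"
  using add_less'[of zero d x] by simp

lemma mul_zero: "x \<in>\<^sub>M R \<Longrightarrow> x \<otimes> zero = zero"
  using distrib[of x zero zero] add_cancel'[of "x \<otimes> zero" zero "x \<otimes> zero"] by simp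

text \<open>If \<open>one\<close> were negative, its additive inverse \<open>m\<close> would be
  positive, and so would \<open>m \<otimes> m\<close>; but this square is
  \<open>one\<close>.\<close>

lemma one_pos: "zero \<sqsubset> one"
proof (rule ccontr)
  assume "\<not> zero \<sqsubset> one"
  then have neg: "one \<sqsubset> zero" using less_linear[of zero one] zero_neq_one by simp
  obtain m where m: "m \<in>\<^sub>M R" "one \<oplus> m = zero" by (rule ex_diff[of one zero]) auto
  have "zero \<sqsubset> m" using add_less[of one zero m] neg m by simp
  then have "zero \<sqsubset> m \<otimes> m" using mul_mono[of m m] m(1) by simp
  \<comment> \<open>Both sides are zero, the left one because it is
    \<open>m \<otimes> (one \<oplus> m)\<close>.\<close>
  moreover have "m \<oplus> m \<otimes> m = m \<oplus> one"
    using distrib[of m one m] m mul_zero[of m] add_comm[of m one] by simp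
  then have "m \<otimes> m = one" using add_cancel'[of "m \<otimes> m" one m] m(1) by simp
  ultimately show False using neg less_asym[of zero one] by simp
qed

lemma mul_less:
  assumes "x \<in>\<^sub>M R" "y \<in>\<^sub>M R" "z \<in>\<^sub>M R" "zero \<sqsubset> z" "x \<sqsubset> y" shows "z \<otimes> x \<sqsubset> z \<otimes> y"
proof -
  obtain d where d: "d \<in>\<^sub>M R" "x \<oplus> d = y" using ex_diff[OF assms(1,2)] .
  then have "zero \<sqsubset> d" using less_add_iff[of x d] assms by simp
  then have "zero \<sqsubset> z \<otimes> d" using mul_mono[of z d] assms d(1) by simp
  then have "z \<otimes> x \<sqsubset> z \<otimes> x \<oplus> z \<otimes> d" using less_add_iff assms d(1) by simp
  then show ?thesis using distrib[of z x d] assms d by simp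
qed

definition inv :: "'a \<Rightarrow> 'a" where "inv x = descr (\<lambda>y. y \<in>\<^sub>M R \<and> x \<otimes> y = one)"

lemma dtm_inv: "dtm t \<Longrightarrow> dtm (\<lambda>e. inv (t e))"
  by (erule dtm_lift1[rotated]) (unfold inv_def, intro dfn_set_intros dtm_times)

lemma inv_eq:
  assumes "x \<in>\<^sub>M R" "y \<in>\<^sub>M R" "x \<otimes> y = one" shows "inv x = y"
  unfolding inv_def
proof (rule descr_eq)
  fix z assume z: "z \<in>\<^sub>M R \<and> x \<otimes> z = one"
  have "z = (x \<otimes> y) \<otimes> z" using z assms by simp
  also have "\<dots> = y \<otimes> (x \<otimes> z)" using assms z mul_comm[of x y] mul_assoc[of y x z] by simp
  finally show "z = y" using z assms by simp
qed (use assms in simp)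

lemma inv_pos:
  assumes x: "x \<in>\<^sub>M R" "zero \<sqsubset> x"
  shows inv_closed: "inv x \<in>\<^sub>M R" and mul_inv: "x \<otimes> inv x = one" and inv_gt: "zero \<sqsubset> inv x"
    and inv_inv: "inv (inv x) = x"
proof -
  obtain y where y: "y \<in>\<^sub>M R" "x \<otimes> y = one" using ex_inv[of x] x less_irrefl by blast
  have "inv x = y" using inv_eq[OF x(1) y] .
  moreover have "inv y = x" using inv_eq[OF y(1) x(1)] y mul_comm[of x y] x(1) by simp
  moreover have "zero \<sqsubset> y"
  proof (rule ccontr)
    assume "\<not> zero \<sqsubset> y"
    then consider "y = zero" | "y \<sqsubset> zero" using less_linear[of zero y] y(1) by auto
    then show False
    proof cases
      case 1
      then show False using y(2) x(1) mul_zero zero_neq_one by simp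
    next
      case 2
      then have "one \<sqsubset> zero" using mul_less[of y zero x] x y mul_zero[of x] by simp
      then show False using one_pos less_asym by simp
    qed
  qed
  ultimately show "inv x \<in>\<^sub>M R" "x \<otimes> inv x = one" "zero \<sqsubset> inv x" "inv (inv x) = x"
    using y by simp_all
qed

text \<open>Otherwise \<open>inv x \<sqsubseteq> inv y\<close>; then
  \<open>x \<otimes> inv x\<close>, which is \<open>one\<close>, is smaller than
  \<open>y \<otimes> inv x\<close>, and this is at most \<open>y \<otimes> inv y\<close>, which is
  \<open>one\<close> again.\<close>

lemma inv_less:
  assumes "x \<in>\<^sub>M R" "y \<in>\<^sub>M R" "zero \<sqsubset> x" "x \<sqsubset> y" shows "inv y \<sqsubset> inv x"
proof (rule ccontr)
  have py: "zero \<sqsubset> y" using less_trans[of zero x y] assms by simp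
  note ix = inv_pos[OF assms(1,3)] and iy = inv_pos[OF assms(2) py]
  assume "\<not> inv y \<sqsubset> inv x"
  then have le: "inv x \<sqsubseteq> inv y" using less_linear ix(1) iy(1) by blast
  have "one \<sqsubset> y \<otimes> inv x"
    using mul_less[of x y "inv x"] ix assms mul_comm[of _ "inv x"] by simp
  moreover have "y \<otimes> inv x \<sqsubseteq> y \<otimes> inv y"
    using le mul_less[OF ix(1) iy(1) assms(2) py] by auto
  ultimately show False
    unfolding iy(2) using less_asym[of one "y \<otimes> inv x"] less_irrefl[of one] assms(2) ix(1) by force
qed

lemma inv_inj: "x \<in>\<^sub>M R \<Longrightarrow> y \<in>\<^sub>M R \<Longrightarrow> zero \<sqsubset> x \<Longrightarrow> zero \<sqsubset> y \<Longrightarrow> inv x = inv y \<Longrightarrow> x = y"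
  by (metis inv_inv)

lemma pos_add: "x \<in>\<^sub>M R \<Longrightarrow> y \<in>\<^sub>M R \<Longrightarrow> zero \<sqsubseteq> x \<Longrightarrow> zero \<sqsubset> y \<Longrightarrow> zero \<sqsubset> x \<oplus> y"
  using less_add_iff[of x y] less_trans[of zero x "x \<oplus> y"] by auto

subsection \<open>The natural numbers of the field\<close>

text \<open>This copy of the natural numbers serves as index set in place of \<open>omega\<close>,
  since its elements can be added to reals, compared with them and, once positive, inverted.\<close>

definition N :: 'a where
  "N = sep R (\<lambda>x. \<forall>S. zero \<in>\<^sub>M S \<and> (\<forall>y. y \<in>\<^sub>M R \<longrightarrow> y \<in>\<^sub>M S \<longrightarrow> y \<oplus> one \<in>\<^sub>M S) \<longrightarrow> x \<in>\<^sub>M S)"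

lemma mem_N: "x \<in>\<^sub>M N \<longleftrightarrow> x \<in>\<^sub>M R \<and>
    (\<forall>S. zero \<in>\<^sub>M S \<and> (\<forall>y. y \<in>\<^sub>M R \<longrightarrow> y \<in>\<^sub>M S \<longrightarrow> y \<oplus> one \<in>\<^sub>M S) \<longrightarrow> x \<in>\<^sub>M S)"
  unfolding N_def by (rule mem_sep) (intro dfn_set_intros dtm_plus)

lemma N_R [simp]: "n \<in>\<^sub>M N \<Longrightarrow> n \<in>\<^sub>M R" and N_zero [simp]: "zero \<in>\<^sub>M N"
  and N_succ [simp]: "n \<in>\<^sub>M N \<Longrightarrow> n \<oplus> one \<in>\<^sub>M N"
  unfolding mem_N by auto

lemma N_induct [consumes 1, case_names def zero succ]:
  assumes n: "n \<in>\<^sub>M N" and d: "dfn1 P" and "P zero"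
    and "\<And>n. n \<in>\<^sub>M N \<Longrightarrow> P n \<Longrightarrow> P (n \<oplus> one)"
  shows "P n"
proof -
  have "zero \<in>\<^sub>M sep N P" "\<forall>y. y \<in>\<^sub>M R \<longrightarrow> y \<in>\<^sub>M sep N P \<longrightarrow> y \<oplus> one \<in>\<^sub>M sep N P"
    using assms(3,4) by (simp_all add: mem_sep[OF d])
  then have "n \<in>\<^sub>M sep N P" using n mem_N by blast
  then show ?thesis unfolding mem_sep[OF d] by simp
qed

lemma N_nonneg: "n \<in>\<^sub>M N \<Longrightarrow> zero \<sqsubseteq> n"
proof (induction rule: N_induct)
  case def
  show ?case by (intro dfn_set_intros Dfn_less)
next
  case (succ n)
  then show ?case using pos_add[of n one] one_pos by simp
qed simp

lemma N_cases: "n \<in>\<^sub>M N \<Longrightarrow> n = zero \<or> (\<exists>m. m \<in>\<^sub>M N \<and> n = m \<oplus> one)"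
proof (induction rule: N_induct)
  case def
  show ?case by (intro dfn_set_intros dtm_plus)
qed auto

lemma less_succ: "n \<in>\<^sub>M R \<Longrightarrow> n \<sqsubset> n \<oplus> one"
  using less_add_iff one_pos by simp

text \<open>Induction on \<open>m\<close>, with \<open>n\<close> quantified inside the predicate
  because the step replaces \<open>n\<close> by its predecessor.\<close>

lemma N_discrete: "m \<in>\<^sub>M N \<Longrightarrow> n \<in>\<^sub>M N \<Longrightarrow> m \<sqsubset> n \<Longrightarrow> m \<oplus> one \<sqsubseteq> n"
proof -
  assume m: "m \<in>\<^sub>M N" and n: "n \<in>\<^sub>M N" "m \<sqsubset> n"
  from m have "\<forall>n. n \<in>\<^sub>M N \<longrightarrow> m \<sqsubset> n \<longrightarrow> m \<oplus> one \<sqsubseteq> n"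
  proof (induction rule: N_induct)
    case def
    show ?case by (intro dfn_set_intros dtm_plus Dfn_less)
  next
    case zero
    show ?case
    proof (intro allI impI)
      fix n assume n: "n \<in>\<^sub>M N" "zero \<sqsubset> n"
      then obtain p where "p \<in>\<^sub>M N" "n = p \<oplus> one" using N_cases less_irrefl by (metis constants(1))
      then show "zero \<oplus> one \<sqsubseteq> n"
        using N_nonneg[of p] add_less[of zero p one] by (metis N_R constants)
    qed
  next
    case (succ m)
    show ?case
    proof (intro allI impI)
      fix n assume n: "n \<in>\<^sub>M N" "m \<oplus> one \<sqsubset> n"
      have "zero \<sqsubset> m \<oplus> one" using pos_add[of m one] N_nonneg[OF succ(1)] succ(1) one_pos by simp
      then have "n \<noteq> zero" using n less_asym[of zero "m \<oplus> one"] succ(1) by auto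
      then obtain p where p: "p \<in>\<^sub>M N" "n = p \<oplus> one" using N_cases n(1) by blast
      then have "m \<sqsubset> p" using n succ(1) add_less[of m p one] by simp
      then have "m \<oplus> one \<sqsubseteq> p" using succ p by blast
      then show "m \<oplus> one \<oplus> one \<sqsubseteq> n" using p succ(1) add_less[of "m \<oplus> one" p one] by auto
    qed
  qed
  with n show ?thesis by blast
qed

lemma less_succ_iff: "m \<in>\<^sub>M N \<Longrightarrow> n \<in>\<^sub>M N \<Longrightarrow> m \<sqsubset> n \<oplus> one \<longleftrightarrow> m \<sqsubseteq> n"
proof -
  assume mn: "m \<in>\<^sub>M N" "n \<in>\<^sub>M N"
  have "\<not> n \<sqsubset> m" if "m \<sqsubset> n \<oplus> one"
    using N_discrete[of n m] mn that less_asym[of m "n \<oplus> one"] less_irrefl[of m] by auto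
  moreover have "m \<sqsubset> n \<oplus> one" if "m \<sqsubseteq> n"
    using that mn less_succ[of n] less_trans[of m n "n \<oplus> one"] by auto
  ultimately show ?thesis using less_linear[of m n] mn by auto
qed

lemma N_add: "m \<in>\<^sub>M N \<Longrightarrow> n \<in>\<^sub>M N \<Longrightarrow> m \<oplus> n \<in>\<^sub>M N"
proof -
  assume m: "m \<in>\<^sub>M N" and "n \<in>\<^sub>M N"
  from this(2) show "m \<oplus> n \<in>\<^sub>M N"
  proof (induction rule: N_induct)
    case def
    show ?case by (intro dfn_set_intros dtm_plus)
  next
    case (succ n)
    then show ?case using m add_assoc[of m n one] by (metis N_R N_succ constants(2))
  qed (use m in simp)
qed

lemma double_less: "m \<in>\<^sub>M R \<Longrightarrow> n \<in>\<^sub>M R \<Longrightarrow> m \<sqsubset> n \<Longrightarrow> m \<oplus> m \<sqsubset> n \<oplus> n"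
  using add_less[of m n m] add_less'[of m n n] less_trans[of "m \<oplus> m" "n \<oplus> m" "n \<oplus> n"] by simp

lemma double_inj: "m \<in>\<^sub>M R \<Longrightarrow> n \<in>\<^sub>M R \<Longrightarrow> m \<oplus> m = n \<oplus> n \<Longrightarrow> m = n"
  using double_less[of m n] double_less[of n m] less_linear[of m n] less_irrefl[of "m \<oplus> m"] by auto

text \<open>The number \<open>n \<oplus> n \<oplus> one\<close> lies strictly between the doubles of
  \<open>n\<close> and of \<open>n \<oplus> one\<close>, and doubling is increasing. This keeps the
  two halves of the coding in \<open>countable_un\<close> apart.\<close>

lemma parity: "m \<in>\<^sub>M N \<Longrightarrow> n \<in>\<^sub>M N \<Longrightarrow> m \<oplus> m \<noteq> n \<oplus> n \<oplus> one"
proof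
  assume mn: "m \<in>\<^sub>M N" "n \<in>\<^sub>M N" and eq: "m \<oplus> m = n \<oplus> n \<oplus> one"
  have "n \<oplus> n \<sqsubset> m \<oplus> m" using eq less_succ[of "n \<oplus> n"] mn by simp
  then have "n \<sqsubset> m"
    using less_linear[of m n] double_less[of m n] less_asym[of "n \<oplus> n" "m \<oplus> m"] less_irrefl[of "n \<oplus> n"] mn
    by auto
  then have le: "n \<oplus> one \<sqsubseteq> m" using N_discrete mn by blast
  have "n \<oplus> n \<oplus> one = n \<oplus> (n \<oplus> one)" using mn add_assoc by simp
  also have "\<dots> \<sqsubset> (n \<oplus> one) \<oplus> (n \<oplus> one)" using mn add_less[of n "n \<oplus> one" "n \<oplus> one"] less_succ by simp
  finally have "m \<oplus> m \<sqsubset> (n \<oplus> one) \<oplus> (n \<oplus> one)" using eq by simp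
  moreover have "(n \<oplus> one) \<oplus> (n \<oplus> one) \<sqsubseteq> m \<oplus> m" using le double_less[of "n \<oplus> one" m] mn by auto
  ultimately show False
    using less_asym[of "m \<oplus> m" "(n \<oplus> one) \<oplus> (n \<oplus> one)"] less_irrefl[of "m \<oplus> m"] mn by auto
qed

text \<open>Here completeness enters: if \<open>N\<close> were bounded, it would have a supremum
  \<open>u\<close>. Then \<open>u\<close> minus one is not an upper bound, and an element of
  \<open>N\<close> beyond it has its successor beyond \<open>u\<close>.\<close>

lemma archimedean:
  assumes x: "x \<in>\<^sub>M R" shows "\<exists>n. n \<in>\<^sub>M N \<and> x \<sqsubset> n"
proof (rule ccontr)
  assume *: "\<not> ?thesis"
  then have "n \<sqsubseteq> x" if "n \<in>\<^sub>M N" for n using that less_linear[of x n] x * by auto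
  then have "upper_bound mem R lt N x" unfolding upper_bound_def using x by blast
  moreover have "M_subset mem N R" "\<not> is_empty mem N"
    unfolding M_subset_def is_empty_def by (auto intro: exI[of _ zero])
  ultimately obtain u where u: "upper_bound mem R lt N u"
    "\<forall>v. upper_bound mem R lt N v \<longrightarrow> u = v \<or> u \<sqsubset> v"
    using complete by blast
  have uR: "u \<in>\<^sub>M R" using u(1) unfolding upper_bound_def by blast
  obtain d where d: "d \<in>\<^sub>M R" "one \<oplus> d = u" using ex_diff[of one u] uR by auto
  then have du: "d \<oplus> one = u" using add_comm by simp
  then have "d \<sqsubset> u" using less_succ[OF d(1)] by simp
  then have "\<not> upper_bound mem R lt N d" using u(2) less_asym[of d u] less_irrefl[of d] d(1) uR by auto
  then obtain n where n: "n \<in>\<^sub>M N" "\<not> n \<sqsubseteq> d" unfolding upper_bound_def using d(1) by blast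
  then have "u \<sqsubset> n \<oplus> one" using less_linear[of n d] d(1) du add_less[of d n one] by auto
  moreover have "n \<oplus> one \<sqsubseteq> u" using u(1) N_succ[OF n(1)] unfolding upper_bound_def by blast
  ultimately show False using less_asym[of u "n \<oplus> one"] less_irrefl[of u] uR n(1) by auto
qed

text \<open>If \<open>S\<close> had no least element, induction would put every \<open>n\<close>
  strictly below all of \<open>S\<close>, so \<open>S\<close> would be empty.\<close>

lemma N_well_order: "strict_well_order mem N (\<lambda>x y. x \<sqsubset> y)"
  unfolding strict_well_order_def
proof (intro conjI allI impI)
  show "strict_linear_order mem N (\<lambda>x y. x \<sqsubset> y)"
    unfolding strict_linear_order_def
    using less_irrefl less_trans less_linear N_R by metis
  fix S assume S: "M_subset mem S N" "\<not> is_empty mem S"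
  show "\<exists>m. m \<in>\<^sub>M S \<and> (\<forall>x. x \<in>\<^sub>M S \<longrightarrow> m = x \<or> m \<sqsubset> x)"
  proof (rule ccontr)
    assume no_min: "\<not> ?thesis"
    have SN: "x \<in>\<^sub>M N" if "x \<in>\<^sub>M S" for x using S(1) that unfolding M_subset_def by blast
    have "\<forall>x. x \<in>\<^sub>M S \<longrightarrow> n \<sqsubset> x" if "n \<in>\<^sub>M N" for n
      using that
    proof (induction rule: N_induct)
      case def
      show ?case by (intro dfn_set_intros Dfn_less)
    next
      case zero
      have le: "zero \<sqsubseteq> x" if "x \<in>\<^sub>M S" for x using N_nonneg[OF SN[OF that]] .
      then have "\<not> zero \<in>\<^sub>M S" using no_min by blast
      with le show ?case by blast
    next
      case (succ n)
      have le: "n \<oplus> one \<sqsubseteq> x" if "x \<in>\<^sub>M S" for x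
        using N_discrete[OF succ(1) SN[OF that]] succ(2) that by blast
      then have "\<not> n \<oplus> one \<in>\<^sub>M S" using no_min by blast
      with le show ?case by blast
    qed
    then have "\<not> x \<in>\<^sub>M S" for x using SN less_irrefl N_R by blast
    then show False using S(2) unfolding is_empty_def by blast
  qed
qed

text \<open>The collapse of \<open>N\<close> sends zero to the empty set and turns adding one into
  the ordinal successor, hence its range is \<open>omega\<close>.\<close>

lemma N_omega: "card_eq mem N omega"
proof -
  have L: "dfn2 (\<lambda>x y. x \<sqsubset> y)" by (intro dfn_set_intros Dfn_less)
  obtain c a where c: "fdef c" "\<And>v. v \<in>\<^sub>M a \<longleftrightarrow> (\<exists>x. x \<in>\<^sub>M N \<and> v = c x)"
    "\<And>x v. x \<in>\<^sub>M N \<Longrightarrow> v \<in>\<^sub>M c x \<longleftrightarrow> (\<exists>y. y \<in>\<^sub>M N \<and> y \<sqsubset> x \<and> v = c y)"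
    "card_eq mem N a"
    by (rule order_type[OF N_well_order L]) blast
  have c0: "c zero = emp"
  proof (rule extensionality, rule allI)
    fix x
    have "\<not> y \<sqsubset> zero" if "y \<in>\<^sub>M N" for y
      using N_nonneg[OF that] less_asym[of y zero] less_irrefl that by auto
    then show "x \<in>\<^sub>M c zero \<longleftrightarrow> x \<in>\<^sub>M emp" using c(3)[OF N_zero] by auto
  qed
  have cS: "c (n \<oplus> one) = succ (c n)" if n: "n \<in>\<^sub>M N" for n
    by (rule extensionality) (use n in \<open>auto simp: c(3) less_succ_iff\<close>)
  have c_omega: "c n \<in>\<^sub>M omega" if "n \<in>\<^sub>M N" for n
    using that
  proof (induction rule: N_induct)
    case def
    show ?case by (intro dfn_set_intros dtm_lift1[OF c(1)])
  qed (auto simp: c0 cS emp_omega succ_omega)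
  have "is_inductive mem a"
    unfolding is_inductive_iff c(2) using c0 cS N_zero N_succ by metis
  then have "x \<in>\<^sub>M a" if "x \<in>\<^sub>M omega" for x using that mem_omega by blast
  moreover have "x \<in>\<^sub>M omega" if "x \<in>\<^sub>M a" for x using that c_omega unfolding c(2) by (elim exE) simp
  ultimately have "a = omega" by (intro extensionality allI iffI)
  with c(4) show ?thesis by simp
qed

lemma card_le_N_iff: "card_le mem A N \<longleftrightarrow> card_le mem A omega"
  using N_omega card_eq_le card_eq_sym card_le_trans by blast

text \<open>Codes of \<open>X\<close> are doubled, and codes of the remaining elements are doubled
  and raised by one. For two sets, fixing a coding of each involves no choice.\<close>

lemma countable_un:
  assumes "card_le mem X omega" "card_le mem Y omega" shows "card_le mem (un X Y) omega"
proof -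
  obtain F where F: "fdef F" "\<And>x. x \<in>\<^sub>M X \<Longrightarrow> F x \<in>\<^sub>M N"
    "\<And>x y. x \<in>\<^sub>M X \<Longrightarrow> y \<in>\<^sub>M X \<Longrightarrow> F x = F y \<Longrightarrow> x = y"
    using assms(1) unfolding card_le_N_iff[symmetric] by (rule card_leE) blast
  obtain G where G: "fdef G" "\<And>x. x \<in>\<^sub>M Y \<Longrightarrow> G x \<in>\<^sub>M N"
    "\<And>x y. x \<in>\<^sub>M Y \<Longrightarrow> y \<in>\<^sub>M Y \<Longrightarrow> G x = G y \<Longrightarrow> x = y"
    using assms(2) unfolding card_le_N_iff[symmetric] by (rule card_leE) blast
  define H where "H x = (if x \<in>\<^sub>M X then F x \<oplus> F x else G x \<oplus> G x \<oplus> one)" for x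
  have "card_le mem (un X Y) N"
  proof (rule card_leI[of H])
    show "fdef H" unfolding H_def by (intro dfn_set_intros dtm_plus F(1) G(1))
    show "H x \<in>\<^sub>M N" if "x \<in>\<^sub>M un X Y" for x using that F(2) G(2) N_add by (auto simp: H_def)
    show "x = y" if xy: "x \<in>\<^sub>M un X Y" "y \<in>\<^sub>M un X Y" and eq: "H x = H y" for x y
    proof -
      have Y: "z \<in>\<^sub>M Y" if "z \<in>\<^sub>M un X Y" "\<not> z \<in>\<^sub>M X" for z using that by simp
      show ?thesis
      proof (cases "x \<in>\<^sub>M X"; cases "y \<in>\<^sub>M X")
        assume "x \<in>\<^sub>M X" "y \<in>\<^sub>M X"
        then show ?thesis using eq F(2,3) double_inj[of "F x" "F y"] by (simp add: H_def)
      next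
        assume "x \<in>\<^sub>M X" "\<not> y \<in>\<^sub>M X"
        then show ?thesis using eq F(2) G(2) Y[OF xy(2)] parity[of "F x" "G y"] by (simp add: H_def)
      next
        assume "\<not> x \<in>\<^sub>M X" "y \<in>\<^sub>M X"
        then show ?thesis using eq F(2) G(2) Y[OF xy(1)] parity[of "F y" "G x"] by (simp add: H_def)
      next
        assume n: "\<not> x \<in>\<^sub>M X" "\<not> y \<in>\<^sub>M X"
        then have Yx: "x \<in>\<^sub>M Y" "y \<in>\<^sub>M Y" using Y xy by blast+
        then have "G x \<in>\<^sub>M R" "G y \<in>\<^sub>M R" using G(2) by simp_all
        then show ?thesis
          using eq n G(3)[OF Yx] double_inj[of "G x" "G y"] by (simp add: H_def add_cancel)
      qed
    qed
  qed
  then show ?thesis unfolding card_le_N_iff .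
qed

definition diff :: "'a \<Rightarrow> 'a \<Rightarrow> 'a" where "diff x y = descr (\<lambda>d. d \<in>\<^sub>M R \<and> y \<oplus> d = x)"

lemma dtm_diff: "dtm t \<Longrightarrow> dtm u \<Longrightarrow> dtm (\<lambda>e. diff (t e) (u e))"
  by (erule (1) dtm_lift2[rotated]) (unfold diff_def, intro dfn_set_intros dtm_plus)

lemma diff:
  assumes "x \<in>\<^sub>M R" "y \<in>\<^sub>M R" shows diff_closed: "diff x y \<in>\<^sub>M R" and add_diff: "y \<oplus> diff x y = x"
proof -
  obtain d where d: "d \<in>\<^sub>M R" "y \<oplus> d = x" using ex_diff[OF assms(2,1)] .
  have "diff x y = d"
    unfolding diff_def by (rule descr_eq) (use d assms add_cancel'[of _ d y] in auto)
  with d show "diff x y \<in>\<^sub>M R" "y \<oplus> diff x y = x" by simp_all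
qed

subsection \<open>An injection of the line into the unit interval\<close>

text \<open>An injection of the line into the positive elements, built from field operations and the
  order and hence definable: negative arguments go below one, the others to at least one.\<close>

definition pos :: "'a \<Rightarrow> 'a" where
  "pos x = (if x \<sqsubset> zero then inv (diff one x) else one \<oplus> x)"

definition squash :: "'a \<Rightarrow> 'a" where "squash x = inv (one \<oplus> pos x)"

lemma dtm_squash: "dtm t \<Longrightarrow> dtm (\<lambda>e. squash (t e))"
  by (erule dtm_lift1[rotated])
    (unfold squash_def pos_def, intro dfn_set_intros dtm_plus dtm_inv dtm_diff Dfn_less)

lemma one_less_diff:
  assumes "x \<in>\<^sub>M R" "x \<sqsubset> zero" shows "one \<sqsubset> diff one x"
  using add_less[of x zero "diff one x"] assms diff[of one x] by simp

lemma inv_one: "inv one = one"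
  by (rule inv_eq) simp_all

lemma pos_neg:
  assumes "x \<in>\<^sub>M R" "x \<sqsubset> zero" shows "pos x \<in>\<^sub>M R" "zero \<sqsubset> pos x" "pos x \<sqsubset> one"
proof -
  have d: "diff one x \<in>\<^sub>M R" "one \<sqsubset> diff one x" using diff_closed one_less_diff assms by simp_all
  then have "zero \<sqsubset> diff one x" using less_trans[of zero one] one_pos by simp
  then show "pos x \<in>\<^sub>M R" "zero \<sqsubset> pos x" "pos x \<sqsubset> one"
    using inv_pos[of "diff one x"] inv_less[of one "diff one x"] d one_pos inv_one assms
    by (simp_all add: pos_def)
qed

lemma pos_nonneg:
  assumes "x \<in>\<^sub>M R" "\<not> x \<sqsubset> zero" shows "pos x = one \<oplus> x" "one \<sqsubseteq> pos x"
  using assms less_linear[of x zero] less_add_iff[of one x] by (auto simp: pos_def)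

lemma pos_gt:
  assumes "x \<in>\<^sub>M R" shows pos_closed: "pos x \<in>\<^sub>M R" and pos_gt_zero: "zero \<sqsubset> pos x"
proof -
  consider "x \<sqsubset> zero" | "pos x = one \<oplus> x" "one \<sqsubseteq> pos x" using pos_nonneg[OF assms] by blast
  then have "pos x \<in>\<^sub>M R \<and> zero \<sqsubset> pos x"
  proof cases
    case 1
    then show ?thesis using pos_neg[OF assms] by blast
  next
    case 2
    have R: "pos x \<in>\<^sub>M R" using 2(1) assms by simp
    then show ?thesis using 2(2) one_pos less_trans[OF constants R one_pos] by auto
  qed
  then show "pos x \<in>\<^sub>M R" "zero \<sqsubset> pos x" by blast+
qed

lemma pos_inj:
  assumes "x \<in>\<^sub>M R" "y \<in>\<^sub>M R" "pos x = pos y" shows "x = y"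
proof -
  have False if "u \<in>\<^sub>M R" "v \<in>\<^sub>M R" "u \<sqsubset> zero" "\<not> v \<sqsubset> zero" "pos u = pos v" for u v
    using pos_neg[OF that(1,3)] pos_nonneg[OF that(2,4)] that(5) less_asym[of "pos u" one]
      less_irrefl[of one] by auto
  then have iff: "x \<sqsubset> zero \<longleftrightarrow> y \<sqsubset> zero" using assms by metis
  show ?thesis
  proof (cases "x \<sqsubset> zero")
    case True
    have gt: "zero \<sqsubset> diff one u" "diff one u \<in>\<^sub>M R" if "u \<in>\<^sub>M R" "u \<sqsubset> zero" for u
      using one_less_diff[OF that] diff_closed[of one u] that(1) less_trans[of zero one] one_pos by auto
    have "inv (diff one x) = inv (diff one y)" using assms(3) True iff by (simp add: pos_def)
    then have "diff one x = diff one y" using inv_inj gt assms True iff by metis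
    then have "x \<oplus> diff one x = y \<oplus> diff one x" using add_diff[of one x] add_diff[of one y] assms by simp
    then show ?thesis using add_cancel assms diff_closed[of one x] by simp
  next
    case False
    then show ?thesis using assms iff add_cancel'[of x y one] by (simp add: pos_def)
  qed
qed

lemma squash:
  assumes "x \<in>\<^sub>M R"
  shows squash_closed: "squash x \<in>\<^sub>M R" and squash_gt: "zero \<sqsubset> squash x" and squash_less: "squash x \<sqsubset> one"
proof -
  have p: "pos x \<in>\<^sub>M R" "zero \<sqsubset> pos x" using pos_gt[OF assms] .
  have lt: "one \<sqsubset> one \<oplus> pos x" using less_add_iff p by simp
  then have "zero \<sqsubset> one \<oplus> pos x" using less_trans[of zero one] one_pos p by simp
  then show "squash x \<in>\<^sub>M R" "zero \<sqsubset> squash x" "squash x \<sqsubset> one"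
    using inv_pos[of "one \<oplus> pos x"] inv_less[of one "one \<oplus> pos x"] lt p one_pos inv_one
    by (simp_all add: squash_def)
qed

lemma squash_inj:
  assumes "x \<in>\<^sub>M R" "y \<in>\<^sub>M R" "squash x = squash y" shows "x = y"
proof -
  have "one \<oplus> pos u \<in>\<^sub>M R" "zero \<sqsubset> one \<oplus> pos u" if "u \<in>\<^sub>M R" for u
    using pos_gt[OF that] pos_add[of one "pos u"] one_pos by simp_all
  then have "one \<oplus> pos x = one \<oplus> pos y"
    using inv_inj[of "one \<oplus> pos x" "one \<oplus> pos y"] assms unfolding squash_def by blast
  then have "pos x = pos y" using add_cancel'[of "pos x" "pos y" one] pos_closed assms(1,2) by simp
  then show ?thesis by (rule pos_inj[OF assms(1,2)])
qed

text \<open>Uniqueness of integer and fractional parts: \<open>n \<sqsubset> m\<close> would give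
  \<open>n \<oplus> r \<sqsubset> n \<oplus> one \<sqsubseteq> m \<sqsubset> m \<oplus>
  s\<close>.\<close>

lemma N_add_unit_inj:
  assumes "n \<in>\<^sub>M N" "m \<in>\<^sub>M N" and r: "r \<in>\<^sub>M R" "zero \<sqsubset> r" "r \<sqsubset> one" and s: "s \<in>\<^sub>M R" "zero \<sqsubset> s" "s \<sqsubset> one"
    and eq: "n \<oplus> r = m \<oplus> s"
  shows "n = m \<and> r = s"
proof -
  have False if "n \<in>\<^sub>M N" "m \<in>\<^sub>M N" "n \<sqsubset> m" "r \<in>\<^sub>M R" "r \<sqsubset> one" "s \<in>\<^sub>M R" "zero \<sqsubset> s" "n \<oplus> r = m \<oplus> s" for n m r s
  proof -
    have "n \<oplus> r \<sqsubset> n \<oplus> one" using add_less'[of r one n] that by simp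
    moreover have "n \<oplus> one \<sqsubseteq> m" using N_discrete that by blast
    ultimately have "n \<oplus> r \<sqsubset> m" using less_trans[of "n \<oplus> r" "n \<oplus> one" m] that by auto
    moreover have "m \<sqsubset> m \<oplus> s" using less_add_iff that by simp
    ultimately show False using less_asym[of m "m \<oplus> s"] that by simp
  qed
  from this[of n m r s] this[of m n s r] have "n = m" using less_linear[of n m] assms by auto
  then show ?thesis using eq add_cancel'[of r s n] r s assms(1) by simp
qed

subsection \<open>Neighbourhoods\<close>

text \<open>The interval of radius \<open>inv (n \<oplus> one)\<close> around \<open>c\<close>. In
  the lower bound the radius is added to \<open>y\<close> to avoid a subtraction, and the index is
  raised by one since \<open>N\<close> contains zero.\<close>

definition nbhd :: "'a \<Rightarrow> 'a \<Rightarrow> 'a" where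
  "nbhd c n = sep R (\<lambda>y. c \<sqsubset> y \<oplus> inv (n \<oplus> one) \<and> y \<sqsubset> c \<oplus> inv (n \<oplus> one))"

lemma mem_nbhd: "y \<in>\<^sub>M nbhd c n \<longleftrightarrow> y \<in>\<^sub>M R \<and> c \<sqsubset> y \<oplus> inv (n \<oplus> one) \<and> y \<sqsubset> c \<oplus> inv (n \<oplus> one)"
  unfolding nbhd_def by (rule mem_sep) (intro dfn_set_intros Dfn_less dtm_plus dtm_inv)

lemma dtm_nbhd: "dtm t \<Longrightarrow> dtm u \<Longrightarrow> dtm (\<lambda>e. nbhd (t e) (u e))"
  by (erule (1) dtm_lift2[rotated])
    (unfold nbhd_def, intro dfn_set_intros Dfn_less dtm_plus dtm_inv)

lemma N_succ_pos: "n \<in>\<^sub>M N \<Longrightarrow> zero \<sqsubset> n \<oplus> one"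
  using pos_add[of n one] N_nonneg[of n] one_pos by simp

lemma nbhd:
  assumes c: "c \<in>\<^sub>M R" and n: "n \<in>\<^sub>M N"
  shows open_nbhd: "is_open mem R lt (nbhd c n)" and center_nbhd: "c \<in>\<^sub>M nbhd c n"
proof -
  define i where "i = inv (n \<oplus> one)"
  have i: "i \<in>\<^sub>M R" "zero \<sqsubset> i" using inv_pos[of "n \<oplus> one"] N_succ_pos[OF n] n by (simp_all add: i_def)
  obtain a where a: "a \<in>\<^sub>M R" "i \<oplus> a = c" using ex_diff[OF i(1) c] .
  have ai: "a \<oplus> i = c" using a i add_comm by simp
  have iff: "y \<in>\<^sub>M nbhd c n \<longleftrightarrow> y \<in>\<^sub>M R \<and> a \<sqsubset> y \<and> y \<sqsubset> c \<oplus> i" for y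
    unfolding mem_nbhd i_def[symmetric] using add_less[OF a(1) _ i(1), of y] unfolding ai by blast
  show "is_open mem R lt (nbhd c n)"
    unfolding is_open_def M_subset_def iff using a(1) closed(1)[OF c i(1)] by blast
  show "c \<in>\<^sub>M nbhd c n"
    unfolding mem_nbhd i_def[symmetric] using c i less_add_iff by simp
qed

lemma ex_inv_less:
  assumes "d \<in>\<^sub>M R" "zero \<sqsubset> d"
  obtains n where "n \<in>\<^sub>M N" "inv (n \<oplus> one) \<sqsubset> d"
proof -
  note inv_d = inv_pos[OF assms]
  obtain n where n: "n \<in>\<^sub>M N" "inv d \<sqsubset> n" using archimedean[OF inv_d(1)] by blast
  have "inv d \<sqsubset> n \<oplus> one" using less_trans[of "inv d" n "n \<oplus> one"] less_succ[of n] n inv_d by simp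
  then have "inv (n \<oplus> one) \<sqsubset> d" using inv_less[of "inv d" "n \<oplus> one"] inv_d n by simp
  with n(1) show thesis by (rule that)
qed

text \<open>By the Archimedean property some radius is below the distance of the two points. The
  auxiliary fact \<open>sep\<close> is applied to \<open>c\<close> and \<open>x\<close> in either
  order, one for each inequality in \<open>mem_nbhd\<close>.\<close>

lemma ex_not_nbhd:
  assumes c: "c \<in>\<^sub>M R" and x: "x \<in>\<^sub>M R" and "x \<noteq> c"
  shows "\<exists>n. n \<in>\<^sub>M N \<and> \<not> x \<in>\<^sub>M nbhd c n"
proof -
  have sep: "\<exists>n. n \<in>\<^sub>M N \<and> \<not> v \<sqsubset> u \<oplus> inv (n \<oplus> one)" if uv: "u \<in>\<^sub>M R" "v \<in>\<^sub>M R" "u \<sqsubset> v" for u v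
  proof -
    obtain d where d: "d \<in>\<^sub>M R" "u \<oplus> d = v" using ex_diff[OF uv(1,2)] .
    then have "zero \<sqsubset> d" using less_add_iff[of u d] uv by simp
    then obtain n where n: "n \<in>\<^sub>M N" "inv (n \<oplus> one) \<sqsubset> d" using ex_inv_less[OF d(1)] by blast
    have i: "inv (n \<oplus> one) \<in>\<^sub>M R" using inv_closed[of "n \<oplus> one"] N_succ_pos[OF n(1)] n(1) by simp
    have "u \<oplus> inv (n \<oplus> one) \<sqsubset> v" using add_less'[OF i d(1) uv(1)] n(2) d(2) by simp
    then show ?thesis using less_asym[of "u \<oplus> inv (n \<oplus> one)" v] i uv n(1) by auto
  qed
  show ?thesis
    unfolding mem_nbhd using less_linear[OF c x] sep[OF c x] sep[OF x c] assms(3) by blast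
qed

subsection \<open>The two implications\<close>

lemma strongly_concentrated_imp_cf:
  assumes AR: "M_subset mem A R" and large: "large mem A" and wo: "well_orderable mem A"
    and conc: "strongly_concentrated mem R lt A"
  shows "\<exists>k. is_aleph_1 mem k \<and> card_le mem k R \<and> is_cf mem k omega"
proof -
  have A_le: "\<not> card_le mem A omega" using large large_iff by blast
  obtain r where r: "strict_well_order mem A (related mem r)" using wo unfolding well_orderable_def by blast
  have r_dfn: "dfn2 (related mem r)" by (intro Dfn_related dfn_intros)
  obtain a where a: "ordinal mem a" "card_eq mem A a" by (rule order_type[OF r r_dfn]) blast
  have "\<not> card_le mem a omega" using A_le a(2) card_eq_le card_le_trans by blast
  then obtain k where k: "is_aleph_1 mem k" "k = a \<or> k \<in>\<^sub>M a" using ex_aleph_1 a(1) by blast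
  have ok: "ordinal mem k" and wk: "omega \<in>\<^sub>M k" using k(1) unfolding is_aleph_1_iff is_aleph_def by blast+
  have "card_le mem k a"
    by (rule subset_card_le) (use k(2) ordinal_trans[OF a(1)] in blast)
  then have "card_le mem k A" using a(2) card_eq_sym card_eq_le card_le_trans by blast
  then obtain G where G: "fdef G" "\<And>x. x \<in>\<^sub>M k \<Longrightarrow> G x \<in>\<^sub>M A"
    "\<And>x y. x \<in>\<^sub>M k \<Longrightarrow> y \<in>\<^sub>M k \<Longrightarrow> G x = G y \<Longrightarrow> x = y"
    by (rule card_leE) blast
  have GR: "G x \<in>\<^sub>M R" if "x \<in>\<^sub>M k" for x using G(2)[OF that] AR unfolding M_subset_def by blast
  have kR: "card_le mem k R" by (rule card_leI[OF G(1)]) (use GR G(3) in blast)+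
  obtain c where c: "c \<in>\<^sub>M R" and conc_c: "concentrated mem R lt A (upair c c)"
    using conc unfolding strongly_concentrated_def by auto
  \<comment> \<open>A point sent to \<open>c\<close> itself lies in no complement of a
    neighbourhood, so it is added to every \<open>Y n\<close>. There is at most one such point, as
    \<open>G\<close> is injective.\<close>
  define Y where "Y n = sep k (\<lambda>b. \<not> G b \<in>\<^sub>M nbhd c n \<or> G b = c)" for n
  have Y: "b \<in>\<^sub>M Y n \<longleftrightarrow> b \<in>\<^sub>M k \<and> (\<not> G b \<in>\<^sub>M nbhd c n \<or> G b = c)" for b n
    unfolding Y_def by (rule mem_sep) (intro dfn_set_intros dtm_nbhd dtm_lift1[OF G(1)])
  have Y_dfn: "fdef Y" unfolding Y_def by (intro dfn_set_intros dtm_nbhd dtm_lift1[OF G(1)])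
  have sing: "fdef (\<lambda>n. upair n n)" by (intro dfn_set_intros)
  \<comment> \<open>The singletons make sure that the family is infinite.\<close>
  define F where "F = un (img N Y) (img omega (\<lambda>n. upair n n))"
  have F: "X \<in>\<^sub>M F \<longleftrightarrow> (\<exists>n. n \<in>\<^sub>M N \<and> X = Y n) \<or> (\<exists>n. n \<in>\<^sub>M omega \<and> X = upair n n)" for X
    unfolding F_def mem_un mem_img[OF Y_dfn] mem_img[OF sing] ..
  have "card_le mem (img N Y) omega" "card_le mem (img omega (\<lambda>n. upair n n)) omega"
    by (intro card_le_img_omega card_eq_le N_omega card_eq_refl Y_dfn sing)+
  then have "card_le mem F omega" unfolding F_def by (rule countable_un)
  moreover have "card_le mem omega F"
    by (rule card_leI[OF sing]) (auto simp: F upair_eq_iff)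
  ultimately have F_omega: "card_eq mem F omega" by (rule card_eq_omegaI)
  have Y_le: "card_le mem (Y n) omega" if n: "n \<in>\<^sub>M N" for n
  proof -
    define P where "P = sep k (\<lambda>b. \<not> G b \<in>\<^sub>M nbhd c n)"
    define Q where "Q = sep k (\<lambda>b. G b = c)"
    have P: "b \<in>\<^sub>M P \<longleftrightarrow> b \<in>\<^sub>M k \<and> \<not> G b \<in>\<^sub>M nbhd c n" for b
      unfolding P_def by (rule mem_sep) (intro dfn_set_intros dtm_lift1[OF G(1)])
    have Q: "b \<in>\<^sub>M Q \<longleftrightarrow> b \<in>\<^sub>M k \<and> G b = c" for b
      unfolding Q_def by (rule mem_sep) (intro dfn_set_intros dtm_lift1[OF G(1)])
    define X where "X = sep A (\<lambda>x. \<not> x \<in>\<^sub>M nbhd c n)"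
    have X: "x \<in>\<^sub>M X \<longleftrightarrow> x \<in>\<^sub>M A \<and> \<not> x \<in>\<^sub>M nbhd c n" for x
      unfolding X_def by (rule mem_sep) (intro dfn_set_intros)
    have "M_subset mem (upair c c) (nbhd c n)" using center_nbhd[OF c n] unfolding M_subset_def by simp
    moreover have "is_Diff mem X A (nbhd c n)" unfolding is_Diff_def using X by blast
    ultimately have "card_le mem X omega"
      using conc_c open_nbhd[OF c n] is_omega_iff unfolding concentrated_def by blast
    moreover have "card_le mem P X"
      by (rule card_leI[OF G(1)]) (use G(2,3) P X in blast)+
    \<comment> \<open>\<open>Q\<close> has at most one element, so even a constant map is injective
      on it.\<close>
    moreover have "card_le mem Q omega"
      by (rule card_leI[OF dtm_const, of _ emp]) (use G(3) Q emp_omega in auto)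
    ultimately have "card_le mem (un P Q) omega" using countable_un card_le_trans by blast
    moreover have "card_le mem (Y n) (un P Q)" by (rule subset_card_le) (use Y P Q in auto)
    ultimately show ?thesis using card_le_trans by blast
  qed
  have "card_less mem X k" if XF: "X \<in>\<^sub>M F" for X
    unfolding card_less_aleph_1[OF k(1)]
  proof (cases "\<exists>n. n \<in>\<^sub>M N \<and> X = Y n")
    case True
    then show "card_le mem X omega" using Y_le by blast
  next
    case False
    then obtain n where "n \<in>\<^sub>M omega" "X = upair n n" using XF unfolding F by blast
    then show "card_le mem X omega" by (intro subset_card_le) simp
  qed
  moreover have "is_Union mem k F"
    unfolding is_Union_def
  proof (intro allI iffI)
    fix b assume b: "b \<in>\<^sub>M k"
    obtain n where "n \<in>\<^sub>M N" "b \<in>\<^sub>M Y n"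
    proof (cases "G b = c")
      case True
      then show thesis using that[of zero] b Y N_zero by blast
    next
      case False
      then obtain n where "n \<in>\<^sub>M N" "\<not> G b \<in>\<^sub>M nbhd c n" using ex_not_nbhd[OF c GR[OF b]] by blast
      then show thesis using that[of n] b Y by blast
    qed
    then show "\<exists>X. X \<in>\<^sub>M F \<and> b \<in>\<^sub>M X" using F by blast
  next
    fix b assume "\<exists>X. X \<in>\<^sub>M F \<and> b \<in>\<^sub>M X"
    \<comment> \<open>A member of one of the singletons is a natural number, hence in
      \<open>k\<close>, since \<open>omega\<close> is in \<open>k\<close> and \<open>k\<close> is
      transitive.\<close>
    then show "b \<in>\<^sub>M k" using F Y ordinal_trans[OF ok wk] by auto
  qed
  ultimately have "union_of_smaller mem k omega"
    unfolding union_of_smaller_def using F_omega card_eq_refl by blast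
  \<comment> \<open>Leastness is clear, because every aleph is \<open>omega\<close> or contains
    it.\<close>
  then have "is_cf mem k omega"
    unfolding is_cf_def using is_aleph_omega aleph_omega_le by blast
  with k(1) kR show ?thesis by blast
qed

lemma cf_imp_strongly_concentrated:
  assumes k: "is_aleph_1 mem k" and kR: "card_le mem k R" and cf: "is_cf mem k omega"
  shows "\<exists>A. M_subset mem A R \<and> large mem A \<and> well_orderable mem A \<and> strongly_concentrated mem R lt A"
proof -
  have ok: "ordinal mem k" and nk: "\<not> card_le mem k omega"
    using k aleph_large unfolding is_aleph_1_iff is_aleph_def by blast+
  obtain f where f: "fdef f" "\<And>x. x \<in>\<^sub>M k \<Longrightarrow> f x \<in>\<^sub>M R"
    "\<And>x y. x \<in>\<^sub>M k \<Longrightarrow> y \<in>\<^sub>M k \<Longrightarrow> f x = f y \<Longrightarrow> x = y"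
    using kR by (rule card_leE) blast
  obtain F U where F: "\<And>X. X \<in>\<^sub>M F \<Longrightarrow> card_less mem X k" "card_eq mem F omega"
    and U: "is_Union mem U F" "card_eq mem U k"
    using cf unfolding is_cf_def union_of_smaller_def by blast
  \<comment> \<open>The union is only equinumerous with \<open>k\<close>, so \<open>k\<close> is
    carried into it by an injection, whose values are then covered by the sets
    \<open>T n\<close>.\<close>
  obtain H where H: "fdef H" "\<And>x. x \<in>\<^sub>M k \<Longrightarrow> H x \<in>\<^sub>M U"
    "\<And>x y. x \<in>\<^sub>M k \<Longrightarrow> y \<in>\<^sub>M k \<Longrightarrow> H x = H y \<Longrightarrow> x = y"
    using card_eq_le[OF card_eq_sym[OF U(2)]] by (rule card_leE) blast
  have "card_eq mem N F" using N_omega F(2) card_eq_sym card_eq_trans by blast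
  then obtain T where T: "fdef T" "\<And>n. n \<in>\<^sub>M N \<Longrightarrow> T n \<in>\<^sub>M F" "\<And>X. X \<in>\<^sub>M F \<Longrightarrow> \<exists>n. n \<in>\<^sub>M N \<and> X = T n"
    by (rule card_eqE) blast
  have T_le: "card_le mem (T n) omega" if "n \<in>\<^sub>M N" for n
    using F(1)[OF T(2)[OF that]] unfolding card_less_aleph_1[OF k] .
  \<comment> \<open>The least index, available because \<open>N\<close> is well-ordered, replaces a
    choice among the sets that contain \<open>H b\<close>.\<close>
  define idx where "idx b = descr (\<lambda>n. n \<in>\<^sub>M N \<and> H b \<in>\<^sub>M T n \<and>
    (\<forall>m. m \<in>\<^sub>M N \<longrightarrow> H b \<in>\<^sub>M T m \<longrightarrow> n \<sqsubseteq> m))" for b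
  have idx_dfn: "fdef idx"
    unfolding idx_def by (intro dfn_set_intros Dfn_less dtm_lift1[OF H(1)] dtm_lift1[OF T(1)])
  have idx: "idx b \<in>\<^sub>M N" "H b \<in>\<^sub>M T (idx b)" if b: "b \<in>\<^sub>M k" for b
  proof -
    obtain X where "X \<in>\<^sub>M F" "H b \<in>\<^sub>M X" using H(2)[OF b] U(1) unfolding is_Union_def by blast
    then obtain n0 where n0: "n0 \<in>\<^sub>M N" "H b \<in>\<^sub>M T n0" using T(3) by blast
    have d: "dfn1 (\<lambda>n. H b \<in>\<^sub>M T n)" by (intro dfn_set_intros dtm_lift1[OF T(1)])
    obtain n where n: "n \<in>\<^sub>M N" "H b \<in>\<^sub>M T n" "\<And>m. m \<in>\<^sub>M N \<Longrightarrow> H b \<in>\<^sub>M T m \<Longrightarrow> n \<sqsubseteq> m"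
      by (rule strict_well_order_min[OF N_well_order d n0]) blast
    have "idx b = n"
      unfolding idx_def
    proof (rule descr_eq)
      show "m = n" if "m \<in>\<^sub>M N \<and> H b \<in>\<^sub>M T m \<and> (\<forall>n. n \<in>\<^sub>M N \<longrightarrow> H b \<in>\<^sub>M T n \<longrightarrow> m \<sqsubseteq> n)" for m
        using that n less_asym[of m n] by auto
    qed (use n in blast)
    with n show "idx b \<in>\<^sub>M N" "H b \<in>\<^sub>M T (idx b)" by simp_all
  qed
  \<comment> \<open>The fractional part is strictly positive, so \<open>h b\<close> can be inverted
    also when the index is zero.\<close>
  define h where "h b = idx b \<oplus> squash (f b)" for b
  have h: "h b \<in>\<^sub>M R" "idx b \<sqsubset> h b" "zero \<sqsubset> h b" if b: "b \<in>\<^sub>M k" for b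
    using squash[OF f(2)[OF b]] idx(1)[OF b] N_nonneg[OF idx(1)[OF b]] less_add_iff
      pos_add[of "idx b" "squash (f b)"] by (simp_all add: h_def)
  define g where "g b = inv (h b)" for b
  have g_dfn: "fdef g"
    unfolding g_def h_def
    by (intro dtm_inv dtm_plus dtm_squash dtm_lift1[OF idx_dfn] dtm_lift1[OF f(1)] dtm_var)
  have g: "g b \<in>\<^sub>M R" "zero \<sqsubset> g b" if "b \<in>\<^sub>M k" for b
    using inv_pos[OF h(1,3)] that by (simp_all add: g_def)
  have g_inj: "x = y" if xy: "x \<in>\<^sub>M k" "y \<in>\<^sub>M k" and eq: "g x = g y" for x y
  proof -
    have "h x = h y" using inv_inj[OF h(1) h(1) h(3) h(3)] xy eq by (simp add: g_def)
    then have "squash (f x) = squash (f y)"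
      using N_add_unit_inj[OF idx(1) idx(1) squash squash, OF xy f(2) f(2) f(2) f(2) f(2) f(2)] xy
      by (simp add: h_def)
    then show ?thesis using squash_inj f(2,3) xy by blast
  qed
  define A where "A = img k g"
  have A: "y \<in>\<^sub>M A \<longleftrightarrow> (\<exists>x. x \<in>\<^sub>M k \<and> y = g x)" for y unfolding A_def by (rule mem_img[OF g_dfn])
  have AR: "M_subset mem A R" unfolding M_subset_def A using g by auto
  have Ak: "card_eq mem k A" by (rule card_eqI[OF g_dfn]) (use A g_inj in auto)
  have "large mem A" unfolding large_iff using Ak nk card_eq_le card_le_trans by blast
  moreover have "well_orderable mem A"
    using well_orderable_card_le[OF card_eq_le[OF card_eq_sym[OF Ak]] ok] .
  moreover have "concentrated mem R lt A (upair zero zero)"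
    unfolding concentrated_def is_omega_iff
  proof (intro conjI allI impI AR)
    show "M_subset mem (upair zero zero) R" unfolding M_subset_def by simp
    fix G X w assume G: "is_open mem R lt G" "M_subset mem (upair zero zero) G"
      and X: "is_Diff mem X A G" and w: "w = omega"
    have "zero \<in>\<^sub>M G" using G(2) unfolding M_subset_def by simp
    then obtain a b where ab: "a \<in>\<^sub>M R" "b \<in>\<^sub>M R" "a \<sqsubset> zero" "zero \<sqsubset> b"
      "\<And>y. y \<in>\<^sub>M R \<Longrightarrow> a \<sqsubset> y \<Longrightarrow> y \<sqsubset> b \<Longrightarrow> y \<in>\<^sub>M G"
      using G(1) unfolding is_open_def by blast
    note inv_b = inv_pos[OF ab(2,4)]
    obtain n where n: "n \<in>\<^sub>M N" "inv b \<sqsubset> n" using archimedean[OF inv_b(1)] by blast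
    \<comment> \<open>With \<open>n\<close> above \<open>inv b\<close>, an index of at least
      \<open>n\<close> makes \<open>h x\<close> exceed \<open>inv b\<close>, so the positive number
      \<open>g x\<close> is below \<open>b\<close>.\<close>
    have g_G: "g x \<in>\<^sub>M G" if x: "x \<in>\<^sub>M k" and le: "\<not> idx x \<sqsubset> n" for x
    proof (rule ab(5)[OF g(1)[OF x]])
      show "a \<sqsubset> g x" using less_trans[of a zero "g x"] ab g[OF x] by simp
      have "n \<sqsubseteq> idx x" using le less_linear[of "idx x" n] n idx(1)[OF x] by auto
      then have "n \<sqsubset> h x" using h[OF x] less_trans[of n "idx x" "h x"] n idx(1)[OF x] by auto
      then have "inv b \<sqsubset> h x" using less_trans[of "inv b" n "h x"] n h[OF x] inv_b by simp
      then show "g x \<sqsubset> b" using inv_less[of "inv b" "h x"] inv_b h[OF x] by (simp add: g_def)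
    qed
    \<comment> \<open>Only initial parts of the family are united, as a definable function of
      \<open>n\<close>, so that the internal induction can derive countability from the binary case.
      The union of all the \<open>T m\<close> is equinumerous with \<open>k\<close> and hence
      uncountable.\<close>
    define V where "V n = bigun (img (sep N (\<lambda>m. m \<sqsubset> n)) T)" for n
    have V_dfn: "fdef V" unfolding V_def by (intro dfn_set_intros Dfn_less dtm_lift1[OF T(1)])
    have V: "x \<in>\<^sub>M V n \<longleftrightarrow> (\<exists>m. m \<in>\<^sub>M N \<and> m \<sqsubset> n \<and> x \<in>\<^sub>M T m)" for x n
    proof -
      have d: "dfn1 (\<lambda>m. m \<sqsubset> n)" by (intro dfn_set_intros Dfn_less)
      show ?thesis unfolding V_def mem_bigun mem_img[OF T(1)] mem_sep[OF d] by blast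
    qed
    from n(1) have V_le: "card_le mem (V n) omega"
    proof (induction rule: N_induct)
      case def
      show ?case by (intro dfn_set_intros Dfn_card_le dtm_lift1[OF V_dfn])
    next
      case zero
      have "\<not> m \<sqsubset> zero" if "m \<in>\<^sub>M N" for m
        using N_nonneg[OF that] less_asym[of m zero] less_irrefl[of zero] that by auto
      then show ?case by (intro subset_card_le) (auto simp: V)
    next
      case (succ n)
      have "card_le mem (V (n \<oplus> one)) (un (V n) (T n))"
        by (rule subset_card_le) (use succ(1) less_succ_iff in \<open>auto simp: V\<close>)
      then show ?case using countable_un[OF succ(2) T_le[OF succ(1)]] card_le_trans by blast
    qed
    define B where "B = sep k (\<lambda>x. idx x \<sqsubset> n)"
    have B: "x \<in>\<^sub>M B \<longleftrightarrow> x \<in>\<^sub>M k \<and> idx x \<sqsubset> n" for x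
      unfolding B_def by (rule mem_sep) (intro Dfn_less dtm_const dtm_lift1[OF idx_dfn] dtm_var)
    \<comment> \<open>\<open>H\<close> itself is the injection, as \<open>H x\<close> lies in the
      set with index \<open>idx x\<close>, which is below \<open>n\<close>.\<close>
    have "card_le mem B (V n)" by (rule card_leI[OF H(1)]) (use H(3) B V idx in blast)+
    then have "card_le mem (img B g) omega"
      using V_le card_le_trans card_le_img_omega g_dfn by blast
    moreover have "card_le mem X (img B g)"
    proof (rule subset_card_le)
      fix y assume "y \<in>\<^sub>M X"
      then have y: "y \<in>\<^sub>M A" "\<not> y \<in>\<^sub>M G" using X unfolding is_Diff_def by blast+
      then obtain x where x: "x \<in>\<^sub>M k" "y = g x" unfolding A by blast
      with y(2) g_G have "x \<in>\<^sub>M B" unfolding B by blast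
      with x(2) show "y \<in>\<^sub>M img B g" unfolding mem_img[OF g_dfn] by blast
    qed
    ultimately show "card_le mem X w" unfolding w using card_le_trans by blast
  qed
  then have "strongly_concentrated mem R lt A"
    unfolding strongly_concentrated_def by (intro exI[of _ zero] exI) simp
  ultimately show ?thesis using AR by blast
qed

end

theorem theorem4p1:
  fixes mem :: "'a \<Rightarrow> 'a \<Rightarrow> bool" and R add mul lt :: 'a
  assumes "ZF_model mem" and "is_real_numbers mem R add mul lt"
  shows "(\<exists>A. M_subset mem A R \<and> large mem A \<and> well_orderable mem A \<and>
              strongly_concentrated mem R lt A)
     \<longleftrightarrow> (\<exists>aleph0 aleph1. is_omega mem aleph0 \<and> is_aleph_1 mem aleph1 \<and>
              (\<exists>f. is_injection mem f aleph1 R) \<and> is_cf mem aleph1 aleph0)"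
proof -
  interpret ZF_model mem by fact
  \<comment> \<open>The neutral elements are existentially quantified in the notion of an ordered
    field; they are fixed here to enter the locale.\<close>
  obtain zero one where field: "is_field mem R add mul zero one"
    and linear: "strict_linear_order mem R (related mem lt)"
    and mono: "\<forall>x y z. mem x R \<longrightarrow> mem y R \<longrightarrow> mem z R \<longrightarrow> related mem lt x y \<longrightarrow>
      related mem lt (app2 mem add x z) (app2 mem add y z)"
      "\<forall>x y. mem x R \<longrightarrow> mem y R \<longrightarrow> related mem lt zero x \<longrightarrow> related mem lt zero y \<longrightarrow>
      related mem lt zero (app2 mem mul x y)"
    using assms(2) unfolding is_real_numbers_def is_ordered_field_def by (elim exE conjE)
  have complete: "\<forall>S. M_subset mem S R \<longrightarrow> \<not> is_empty mem S \<longrightarrow> (\<exists>u. upper_bound mem R lt S u) \<longrightarrow>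
      (\<exists>u. upper_bound mem R lt S u \<and> (\<forall>v. upper_bound mem R lt S v \<longrightarrow> u = v \<or> related mem lt u v))"
    using assms(2) unfolding is_real_numbers_def by (elim conjE)
  interpret real_line mem R add mul lt zero one
  proof (unfold_locales, goal_cases)
    case 1 show ?case by (rule field)
  next
    case 2 show ?case by (rule linear)
  next
    case (3 x y z) then show ?case using mono(1) by simp
  next
    case (4 x y) then show ?case using mono(2) by simp
  next
    case (5 S u) show ?case by (rule complete[rule_format, OF 5(1,2) exI, OF 5(3)])
  qed
  show ?thesis (is "?L \<longleftrightarrow> ?R")
  proof
    assume ?L
    then obtain k where "is_aleph_1 mem k" "card_le mem k R" "is_cf mem k omega"
      using strongly_concentrated_imp_cf by (elim exE conjE) blast
    then show ?R
      by (intro exI[of _ omega] exI[of _ k]) (simp add: is_omega_iff flip: card_le_def)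
  next
    assume ?R
    then obtain k where "is_aleph_1 mem k" "card_le mem k R" "is_cf mem k omega"
      unfolding is_omega_iff card_le_def[symmetric] by (elim exE conjE) simp
    then show ?L by (rule cf_imp_strongly_concentrated)
  qed
qed

end
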